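(* Suppose that $T$ is braided and that for every $m\ge 2$ $$\ker(\mathbf{1}_{\mathcal{H}^{\otimes(m+1)}}-T_1T_2\cdots T_m)=\{0\}\quad\text{and}\quad \ker(\mathbf{1}_{\mathcal{H}^{\otimes(m+1)}}-T_1^2T_2\cdots T_m)=\{0\}.$$ Then $\mathcal{K}_m=\ker R_m$ for all $m\ge 2$, and hence $\mathcal{K}_m$ generates the largest homogeneous Wick ideal of degree $m$ for every $m\ge 2$.
   Context: Let $d\ge 1$ and let $\{T_{ij}^{kl}: i,j,k,l=1,\ldots,d\}\subset\mathbb{C}$ satisfy $T_{ji}^{lk}=\overline{T_{ij}^{kl}}$. The Wick algebra $W(T)$ is the unital $*$-algebra generated by $a_i,a_i^*$, $i=1,\ldots,d$, with relations $a_i^*a_j=\delta_{ij}1+\sum_{k,l=1}^d T_{ij}^{kl}a_la_k^*$. Let $\mathcal{H}$ be the $d$-dimensional Hilbert space with orthonormal basis $e_1,\ldots,e_d$, and $\mathcal{H}^*$ its formal dual with basis $e_1^*,\ldots,e_d^*$. Identify $e_i$ with $a_i$ and $e_i^*$ with $a_i^*$; the product of $W(T)$ is then written $\otimes$, and the full tensor algebras $\mathcal{T}(\mathcal{H})$, $\mathcal{T}(\mathcal{H}^* )$ are the subalgebras of $W(T)$ generated by the $a_i$, respectively by the $a_i^*$. For subspaces $U,V\subset W(T)$, $U\otimes V$ is the linear span of all products $u\otimes v$. A two-sided ideal $\mathcal{I}\subset\mathcal{T}(\mathcal{H})$ is a Wick ideal if $\mathcal{T}(\mathcal{H}^* )\otimes\mathcal{I}\subset\mathcal{I}\otimes\mathcal{T}(\mathcal{H}^*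 )$ in $W(T)$. If $\mathcal{I}$ is generated, as a two-sided ideal of $\mathcal{T}(\mathcal{H})$, by a subspace $\mathcal{I}_0\subset\mathcal{H}^{\otimes n}$, it is called a homogeneous Wick ideal of degree $n$. The largest homogeneous Wick ideal of degree $n$ is the one containing every homogeneous Wick ideal of degree $n$. The (self-adjoint) operator $T:\mathcal{H}^{\otimes2}\to\mathcal{H}^{\otimes2}$ is $T(e_k\otimes e_l)=\sum_{i,j}T_{ik}^{lj}e_i\otimes e_j$. On a tensor power of $\mathcal{H}$, $T_i$ denotes $T$ acting in the $i$-th and $(i+1)$-st tensor factors and the identity elsewhere. $T$ is braided if $T_1T_2T_1=T_2T_1T_2$ on $\mathcal{H}^{\otimes3}$. For $n\ge2$, $R_n=\mathbf{1}_{\mathcal{H}^{\otimes n}}+T_1+T_1T_2+\cdots+T_1T_2\cdots T_{n-1}$ on $\mathcal{H}^{\otimes n}$. Put $\mathcal{K}_2=\ker R_2$ and $\mathcal{K}_{m+1}=(\mathbf{1}_{\mathcal{H}^{\otimes(m+1)}}-T_1T_2\cdots T_m)(\mathcal{K}_m\otimes\mathcal{H})$ for $m\ge2$. *)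

theory Defs
  imports
    Complex_Main
    "HOL-Library.Poly_Mapping"
    "HOL-Algebra.QuotRing"
    "HOL-Algebra.Module"
    "HOL-Algebra.Subrings"
    "HOL-Algebra.Algebraic_Closure_Type"
begin

section \<open>Free complex algebras\<close>

text \<open>
  Lists with concatenation form the free monoid, so finitely supported complex functions on
  lists, with the convolution product of \<^theory>\<open>HOL-Library.Poly_Mapping\<close>, form the free unital
  complex algebra: the list \<open>[x1, \<dots>, xn]\<close> stands for the monomial \<open>x1 \<otimes> \<dots> \<otimes> xn\<close>.
\<close>

instantiation list :: (type) monoid_add
begin

definition zero_list :: "'a list" where "zero_list = []"
definition plus_list :: "'a list \<Rightarrow> 'a list \<Rightarrow> 'a list" where "plus_list = (@)"

instance by standard (simp_all add: zero_list_def plus_list_def)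

end

type_synonym 'a free_alg = "'a list \<Rightarrow>\<^sub>0 complex"

definition word_monom :: "'a list \<Rightarrow> 'a free_alg" where
  "word_monom w = Poly_Mapping.single w 1"

definition cscale :: "complex \<Rightarrow> 'a free_alg \<Rightarrow> 'a free_alg" where
  "cscale c x = Poly_Mapping.map ((*) c) x"

lemma cscale_conv_mult: "cscale c x = Poly_Mapping.single 0 c * x"
  by (simp add: cscale_def mult_map_scale_conv_mult)

lemma word_monom_mult: "word_monom v * word_monom w = word_monom (v @ w)"
  by (simp add: word_monom_def mult_single plus_list_def)

lemma word_monom_Nil: "word_monom [] = 1"
  by (simp add: word_monom_def flip: zero_list_def)

lemma lookup_cscale [simp]: "Poly_Mapping.lookup (cscale c x) w = c * Poly_Mapping.lookup x w"
  by (simp add: cscale_def map.rep_eq when_def)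

interpretation cvec: vector_space cscale
  by unfold_locales (auto intro!: poly_mapping_eqI simp: lookup_add algebra_simps)

definition lin_ext :: "('a list \<Rightarrow> 'b free_alg) \<Rightarrow> 'a free_alg \<Rightarrow> 'b free_alg" where
  "lin_ext f x = (\<Sum>w\<in>Poly_Mapping.keys x. cscale (Poly_Mapping.lookup x w) (f w))"

lemma lin_ext_superset:
  assumes "finite A" "Poly_Mapping.keys x \<subseteq> A"
  shows "lin_ext f x = (\<Sum>w\<in>A. cscale (Poly_Mapping.lookup x w) (f w))"
  unfolding lin_ext_def
  by (rule sum.mono_neutral_left) (use assms in \<open>auto simp: in_keys_iff\<close>)

lemma lin_ext_word_monom [simp]: "lin_ext f (word_monom w) = f w"
  by (simp add: lin_ext_def word_monom_def)

lemma lin_ext_add: "lin_ext f (x + y) = lin_ext f x + lin_ext f y"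
proof -
  let ?A = "Poly_Mapping.keys x \<union> Poly_Mapping.keys y"
  have "Poly_Mapping.keys (x + y) \<subseteq> ?A"
    by (rule Poly_Mapping.keys_add)
  then show ?thesis
    by (simp add: lin_ext_superset[of ?A] lookup_add cvec.scale_left_distrib sum.distrib)
qed

lemma lin_ext_cscale: "lin_ext f (cscale c x) = cscale c (lin_ext f x)"
proof -
  have "Poly_Mapping.keys (cscale c x) \<subseteq> Poly_Mapping.keys x"
    by (auto simp: in_keys_iff)
  then show ?thesis
    by (simp add: lin_ext_superset[of "Poly_Mapping.keys x"] cvec.scale_sum_right)
qed


section \<open>Tensor powers and the operators on them\<close>

text \<open>
  The index type \<open>'d\<close> is \<open>{1, \<dots>, d}\<close>; the algebra \<^typ>\<open>'d free_alg\<close> is the full tensor algebra of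
  \<open>\<H>\<close>, and \<^term>\<open>word_monom [i]\<close> is the basis vector \<open>e\<^sub>i\<close>.
\<close>

definition tpow :: "nat \<Rightarrow> 'd free_alg set" where
  "tpow n = {x. \<forall>w\<in>Poly_Mapping.keys x. length w = n}"

definition tensor :: "'d free_alg set \<Rightarrow> 'd free_alg set \<Rightarrow> 'd free_alg set" where
  "tensor U V = cvec.span {x * y | x y. x \<in> U \<and> y \<in> V}"

text \<open>The coefficients are curried as \<open>T i j k l\<close> for \<open>T\<^sub>i\<^sub>j\<^sup>k\<^sup>l\<close>.\<close>

type_synonym 'd coeffs = "'d \<Rightarrow> 'd \<Rightarrow> 'd \<Rightarrow> 'd \<Rightarrow> complex"

definition T_basis :: "('d::finite) coeffs \<Rightarrow> 'd \<Rightarrow> 'd \<Rightarrow> 'd free_alg" where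
  "T_basis T k l = (\<Sum>i\<in>UNIV. \<Sum>j\<in>UNIV. cscale (T i k l j) (word_monom [i, j]))"

text \<open>
  \<open>T_at T i\<close> is the operator \<open>T\<^sub>i\<close> on all tensor powers simultaneously, with factors counted
  from 1; in particular \<open>T_at T 1\<close> on \<open>tpow 2\<close> is the operator \<open>T\<close> itself. It is meaningful on
  \<open>tpow n\<close> only for \<open>1 \<le> i < n\<close>.
\<close>

definition T_at :: "('d::finite) coeffs \<Rightarrow> nat \<Rightarrow> 'd free_alg \<Rightarrow> 'd free_alg" where
  "T_at T i = lin_ext (\<lambda>w. word_monom (take (i - 1) w) * T_basis T (w ! (i - 1)) (w ! i)
                           * word_monom (drop (i + 1) w))"

primrec T_prod :: "('d::finite) coeffs \<Rightarrow> nat \<Rightarrow> 'd free_alg \<Rightarrow> 'd free_alg" where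
  "T_prod T 0 = id"
| "T_prod T (Suc m) = T_prod T m \<circ> T_at T (Suc m)"

definition braided :: "('d::finite) coeffs \<Rightarrow> bool" where
  "braided T \<longleftrightarrow> (\<forall>x\<in>tpow 3. T_at T 1 (T_at T 2 (T_at T 1 x)) = T_at T 2 (T_at T 1 (T_at T 2 x)))"

definition R_op :: "('d::finite) coeffs \<Rightarrow> nat \<Rightarrow> 'd free_alg \<Rightarrow> 'd free_alg" where
  "R_op T n x = (\<Sum>k<n. T_prod T k x)"

definition ker_on :: "nat \<Rightarrow> ('d free_alg \<Rightarrow> 'd free_alg) \<Rightarrow> 'd free_alg set" where
  "ker_on n A = {x \<in> tpow n. A x = 0}"

text \<open>Only the values for \<open>m \<ge> 2\<close> are meaningful.\<close>

primrec K_space :: "('d::finite) coeffs \<Rightarrow> nat \<Rightarrow> 'd free_alg set" where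
  "K_space T 0 = {0}"
| "K_space T (Suc m) =
     (if m < 2 then ker_on 2 (R_op T 2)
      else (\<lambda>x. x - T_prod T m x) ` tensor (K_space T m) (tpow 1))"


section \<open>The Wick algebra\<close>

text \<open>
  \<open>Gen i\<close> stands for \<open>a\<^sub>i\<close> and \<open>Adj i\<close> for \<open>a\<^sub>i\<^sup>*\<close>. The free algebra on these letters carries the
  antilinear involution \<open>free_star\<close>; the Wick algebra is its quotient by the smallest *-closed
  two-sided ideal containing the relations, so that the involution descends.
\<close>

datatype 'd letter = Gen 'd | Adj 'd

primrec letter_star :: "'d letter \<Rightarrow> 'd letter" where
  "letter_star (Gen i) = Adj i"
| "letter_star (Adj i) = Gen i"

definition free_star :: "'d letter free_alg \<Rightarrow> 'd letter free_alg" where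
  "free_star x = (\<Sum>w\<in>Poly_Mapping.keys x.
     cscale (cnj (Poly_Mapping.lookup x w)) (word_monom (rev (map letter_star w))))"

lemma letter_star_star [simp]: "letter_star (letter_star a) = a"
  by (cases a) simp_all

lemma free_star_superset:
  assumes "finite A" "Poly_Mapping.keys x \<subseteq> A"
  shows "free_star x =
    (\<Sum>w\<in>A. cscale (cnj (Poly_Mapping.lookup x w)) (word_monom (rev (map letter_star w))))"
  unfolding free_star_def
  by (rule sum.mono_neutral_left) (use assms in \<open>auto simp: in_keys_iff\<close>)

lemma free_star_add: "free_star (x + y) = free_star x + free_star y"
proof -
  let ?A = "Poly_Mapping.keys x \<union> Poly_Mapping.keys y"
  have "Poly_Mapping.keys (x + y) \<subseteq> ?A"
    by (rule Poly_Mapping.keys_add)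
  then show ?thesis
    by (simp add: free_star_superset[of ?A] lookup_add cvec.scale_left_distrib sum.distrib)
qed

lemma free_star_single:
  "free_star (Poly_Mapping.single w c) = Poly_Mapping.single (rev (map letter_star w)) (cnj c)"
  by (cases "c = 0") (simp_all add: free_star_def word_monom_def cscale_def)

lemma free_alg_induct [case_names single add]:
  fixes x :: "'a free_alg"
  assumes single: "\<And>w c. P (Poly_Mapping.single w c)"
    and add: "\<And>x y. P x \<Longrightarrow> P y \<Longrightarrow> P (x + y)"
  shows "P x"
proof (induction x rule: update_induct)
  case const
  show ?case using single[of "[]" 0] by simp
next
  case (update x w c)
  have "Poly_Mapping.update w c x = Poly_Mapping.single w c + x"
    using update.hyps
    by (intro poly_mapping_eqI) (auto simp: lookup_update lookup_add lookup_single in_keys_iff)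
  then show ?case using add[OF single update.IH] by simp
qed

lemma free_star_star: "free_star (free_star x) = x"
  by (induction x rule: free_alg_induct) (simp_all add: free_star_single free_star_add rev_map comp_def)

lemma free_star_mult: "free_star (x * y) = free_star y * free_star x"
proof (induction x rule: free_alg_induct)
  case (single v c)
  show ?case
    by (induction y rule: free_alg_induct)
      (simp_all add: free_star_single free_star_add mult_single plus_list_def algebra_simps)
qed (simp add: free_star_add algebra_simps)

definition wick_rel :: "('d::finite) coeffs \<Rightarrow> 'd \<Rightarrow> 'd \<Rightarrow> 'd letter free_alg" where
  "wick_rel T i j = word_monom [Adj i, Gen j] -
     ((if i = j then 1 else 0) +
      (\<Sum>k\<in>UNIV. \<Sum>l\<in>UNIV. cscale (T i j k l) (word_monom [Gen l, Adj k])))"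

abbreviation free_ring :: "'a free_alg ring" where
  "free_ring \<equiv> ring_of_type_algebra"

abbreviation complex_ring :: "complex ring" where
  "complex_ring \<equiv> ring_of_type_algebra"

definition wick_rel_ideal :: "('d::finite) coeffs \<Rightarrow> 'd letter free_alg set" where
  "wick_rel_ideal T = \<Inter>{J. ideal J free_ring \<and> free_star ` J \<subseteq> J \<and> (\<forall>i j. wick_rel T i j \<in> J)}"

definition wick_class :: "('d::finite) coeffs \<Rightarrow> 'd letter free_alg \<Rightarrow> 'd letter free_alg set" where
  "wick_class T x = wick_rel_ideal T +>\<^bsub>free_ring\<^esub> x"

definition wick_algebra :: "('d::finite) coeffs \<Rightarrow> (complex, 'd letter free_alg set) module" where
  "wick_algebra T =
     (let Q = free_ring Quot wick_rel_ideal T in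
      \<lparr>carrier = carrier Q, monoid.mult = monoid.mult Q, one = one Q, zero = zero Q, add = add Q,
       module.smult = (\<lambda>c x. wick_class T (Poly_Mapping.single 0 c) \<otimes>\<^bsub>Q\<^esub> x)\<rparr>)"

lemma ring_free_ring: "ring (free_ring :: 'a free_alg ring)"
proof -
  have "\<exists>y. x + y = 0" for x :: "'a free_alg"
    by (rule exI[of _ "- x"]) simp
  moreover from this have "\<exists>y. y + x = 0" for x :: "'a free_alg"
    by (metis add.commute)
  ultimately show ?thesis
    unfolding ring_of_type_algebra_def
    by unfold_locales (auto simp: algebra_simps Units_def)
qed

lemma wick_rel_ideal_is_ideal: "ideal (wick_rel_ideal T) free_ring"
  unfolding wick_rel_ideal_def
proof (rule ring.i_Intersect[OF ring_free_ring])
  have "ideal (carrier free_ring) (free_ring :: 'a letter free_alg ring)"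
    by (rule ring.oneideal[OF ring_free_ring])
  then show "{J. ideal J free_ring \<and> free_star ` J \<subseteq> J \<and> (\<forall>i j. wick_rel T i j \<in> J)} \<noteq> {}"
    by (auto simp: ring_of_type_algebra_def)
qed simp

lemma wick_rel_ideal_star: "x \<in> wick_rel_ideal T \<Longrightarrow> free_star x \<in> wick_rel_ideal T"
  by (auto simp: wick_rel_ideal_def)

lemma wick_class_eq_iff: "wick_class T x = wick_class T y \<longleftrightarrow> x - y \<in> wick_rel_ideal T"
proof -
  interpret ideal "wick_rel_ideal T" free_ring by (rule wick_rel_ideal_is_ideal)
  have *: "wick_class T x = (\<lambda>a. a + x) ` wick_rel_ideal T" for x
    by (auto simp: wick_class_def a_r_coset_def' ring_of_type_algebra_def)
  have add: "a + b \<in> wick_rel_ideal T" if "a \<in> wick_rel_ideal T" "b \<in> wick_rel_ideal T" for a b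
    using additive_subgroup.a_closed[OF is_additive_subgroup that] by (simp add: ring_of_type_algebra_def)
  have zero: "0 \<in> wick_rel_ideal T"
    using additive_subgroup.zero_closed[OF is_additive_subgroup] by (simp add: ring_of_type_algebra_def)
  have neg: "- a \<in> wick_rel_ideal T" if "a \<in> wick_rel_ideal T" for a
    using I_l_closed[OF that, of "- 1"] by (simp add: ring_of_type_algebra_def)
  show ?thesis
  proof
    assume "wick_class T x = wick_class T y"
    moreover have "x \<in> wick_class T x"
      unfolding * using zero by (auto intro!: image_eqI[of _ _ 0])
    ultimately show "x - y \<in> wick_rel_ideal T"
      by (auto simp: *)
  next
    assume d: "x - y \<in> wick_rel_ideal T"
    have "a + x \<in> (\<lambda>a. a + y) ` wick_rel_ideal T" if "a \<in> wick_rel_ideal T" for a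
      using add[OF that d] by (intro image_eqI[of _ _ "a + (x - y)"]) auto
    moreover have "a + y \<in> (\<lambda>a. a + x) ` wick_rel_ideal T" if "a \<in> wick_rel_ideal T" for a
      using add[OF that neg[OF d]] by (intro image_eqI[of _ _ "a + - (x - y)"]) auto
    ultimately show "wick_class T x = wick_class T y"
      unfolding * by blast
  qed
qed

lemma carrier_wick_algebra: "carrier (wick_algebra T) = range (wick_class T)"
  by (auto simp: wick_algebra_def Let_def FactRing_def A_RCOSETS_def' a_r_coset_def' wick_class_def ring_of_type_algebra_def)

lemma wick_algebra_simps:
  "\<one>\<^bsub>wick_algebra T\<^esub> = wick_class T 1"
  "\<zero>\<^bsub>wick_algebra T\<^esub> = wick_class T 0"
  "wick_class T x \<otimes>\<^bsub>wick_algebra T\<^esub> wick_class T y = wick_class T (x * y)"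
  "wick_class T x \<oplus>\<^bsub>wick_algebra T\<^esub> wick_class T y = wick_class T (x + y)"
  "c \<odot>\<^bsub>wick_algebra T\<^esub> wick_class T x = wick_class T (cscale c x)"
proof -
  interpret ideal "wick_rel_ideal T" free_ring by (rule wick_rel_ideal_is_ideal)
  have [simp]: "x \<in> carrier free_ring" for x :: "'a letter free_alg"
    by (simp add: ring_of_type_algebra_def)
  have [simp]: "x \<otimes>\<^bsub>free_ring\<^esub> y = x * y" "x \<oplus>\<^bsub>free_ring\<^esub> y = x + y"
      "\<one>\<^bsub>free_ring\<^esub> = (1 :: 'a letter free_alg)" "\<zero>\<^bsub>free_ring\<^esub> = (0 :: 'a letter free_alg)"
    for x y :: "'a letter free_alg"
    by (simp_all add: ring_of_type_algebra_def)
  have mult: "wick_class T x \<otimes>\<^bsub>free_ring Quot wick_rel_ideal T\<^esub> wick_class T y = wick_class T (x * y)" for x y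
    using rcoset_mult_add[of x y] by (simp add: wick_class_def FactRing_def)
  show "\<one>\<^bsub>wick_algebra T\<^esub> = wick_class T 1"
    by (simp add: wick_algebra_def Let_def FactRing_def wick_class_def)
  show "\<zero>\<^bsub>wick_algebra T\<^esub> = wick_class T 0"
    using a_coset_add_zero[OF a_subset] by (simp add: wick_algebra_def Let_def FactRing_def wick_class_def)
  show "wick_class T x \<otimes>\<^bsub>wick_algebra T\<^esub> wick_class T y = wick_class T (x * y)"
    using mult by (simp add: wick_algebra_def Let_def)
  show "wick_class T x \<oplus>\<^bsub>wick_algebra T\<^esub> wick_class T y = wick_class T (x + y)"
    using a_rcos_sum[of x y] by (simp add: wick_algebra_def Let_def FactRing_def wick_class_def)
  show "c \<odot>\<^bsub>wick_algebra T\<^esub> wick_class T x = wick_class T (cscale c x)"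
    using mult by (simp add: wick_algebra_def Let_def cscale_conv_mult)
qed

lemma ring_wick_algebra: "ring (wick_algebra T)"
proof (rule ringI)
  show "abelian_group (wick_algebra T)"
  proof (rule abelian_groupI)
    fix x assume "x \<in> carrier (wick_algebra T)"
    then obtain a where "x = wick_class T a"
      by (auto simp: carrier_wick_algebra)
    then show "\<exists>y\<in>carrier (wick_algebra T). y \<oplus>\<^bsub>wick_algebra T\<^esub> x = \<zero>\<^bsub>wick_algebra T\<^esub>"
      by (auto simp: carrier_wick_algebra wick_algebra_simps intro!: exI[of _ "- a"])
  qed (auto simp: carrier_wick_algebra wick_algebra_simps algebra_simps)
  show "Group.monoid (wick_algebra T)"
    by (rule monoidI) (auto simp: carrier_wick_algebra wick_algebra_simps algebra_simps)
qed (auto simp: carrier_wick_algebra wick_algebra_simps algebra_simps)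

lemma module_wick_algebra: "module complex_ring (wick_algebra T)"
proof (rule moduleI)
  show "cring complex_ring"
    by (rule cring_from_type_algebra)
  show "abelian_group (wick_algebra T)"
    by (rule ring.is_abelian_group[OF ring_wick_algebra])
qed (auto simp: carrier_wick_algebra wick_algebra_simps ring_of_type_algebra_def cvec.scale_left_distrib cvec.scale_right_distrib)

lemma wick_relation:
  "wick_class T (word_monom [Adj i]) \<otimes>\<^bsub>wick_algebra T\<^esub> wick_class T (word_monom [Gen j]) =
   wick_class T ((if i = j then 1 else 0) +
     (\<Sum>k\<in>UNIV. \<Sum>l\<in>UNIV. cscale (T i j k l) (word_monom [Gen l] * word_monom [Adj k])))"
  using wick_class_eq_iff[of T "word_monom [Adj i, Gen j]"]
  by (auto simp: wick_algebra_simps word_monom_mult wick_rel_ideal_def wick_rel_def)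

definition wick_span :: "('d::finite) coeffs \<Rightarrow> 'd letter free_alg set set \<Rightarrow> 'd letter free_alg set set" where
  "wick_span T S = \<Inter>{U. submodule U complex_ring (wick_algebra T) \<and> S \<subseteq> U}"

definition wick_tensor ::
  "('d::finite) coeffs \<Rightarrow> 'd letter free_alg set set \<Rightarrow> 'd letter free_alg set set
     \<Rightarrow> 'd letter free_alg set set" where
  "wick_tensor T U V = wick_span T {x \<otimes>\<^bsub>wick_algebra T\<^esub> y | x y. x \<in> U \<and> y \<in> V}"

definition wick_subalgebra :: "('d::finite) coeffs \<Rightarrow> 'd letter free_alg set set \<Rightarrow> 'd letter free_alg set set" where
  "wick_subalgebra T S =
     \<Inter>{A. subring A (wick_algebra T) \<and> submodule A complex_ring (wick_algebra T) \<and> S \<subseteq> A}"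

definition TH :: "('d::finite) coeffs \<Rightarrow> 'd letter free_alg set set" where
  "TH T = wick_subalgebra T (range (\<lambda>i. wick_class T (word_monom [Gen i])))"

definition TH_dual :: "('d::finite) coeffs \<Rightarrow> 'd letter free_alg set set" where
  "TH_dual T = wick_subalgebra T (range (\<lambda>i. wick_class T (word_monom [Adj i])))"

abbreviation TH_ring :: "('d::finite) coeffs \<Rightarrow> (complex, 'd letter free_alg set) module" where
  "TH_ring T \<equiv> (wick_algebra T)\<lparr>carrier := TH T\<rparr>"

text \<open>
  The identification of \<open>e\<^sub>i\<close> with \<open>a\<^sub>i\<close>: the tensor \<open>e\<^sub>i \<otimes> e\<^sub>j \<otimes> \<dots>\<close> is sent to the product
  \<open>a\<^sub>i a\<^sub>j \<dots>\<close> in the Wick algebra.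
\<close>

definition to_wick :: "('d::finite) coeffs \<Rightarrow> 'd free_alg \<Rightarrow> 'd letter free_alg set" where
  "to_wick T x = wick_class T (lin_ext (\<lambda>w. word_monom (map Gen w)) x)"


section \<open>Wick ideals\<close>

definition wick_ideal :: "('d::finite) coeffs \<Rightarrow> 'd letter free_alg set set \<Rightarrow> bool" where
  "wick_ideal T I \<longleftrightarrow>
     ideal I (TH_ring T) \<and> wick_tensor T (TH_dual T) I \<subseteq> wick_tensor T I (TH_dual T)"

definition generated_ideal :: "('d::finite) coeffs \<Rightarrow> 'd free_alg set \<Rightarrow> 'd letter free_alg set set" where
  "generated_ideal T I0 = genideal (TH_ring T) (to_wick T ` I0)"

definition homogeneous_wick_ideal :: "('d::finite) coeffs \<Rightarrow> nat \<Rightarrow> 'd letter free_alg set set \<Rightarrow> bool" where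
  "homogeneous_wick_ideal T n I \<longleftrightarrow>
     wick_ideal T I \<and> (\<exists>I0. cvec.subspace I0 \<and> I0 \<subseteq> tpow n \<and> I = generated_ideal T I0)"

definition largest_homogeneous_wick_ideal ::
  "('d::finite) coeffs \<Rightarrow> nat \<Rightarrow> 'd letter free_alg set set \<Rightarrow> bool" where
  "largest_homogeneous_wick_ideal T n I \<longleftrightarrow>
     homogeneous_wick_ideal T n I \<and> (\<forall>I'. homogeneous_wick_ideal T n I' \<longrightarrow> I' \<subseteq> I)"

end

theory Submission
  imports Defs
begin

text \<open>
  Write \<open>U = T\<^sub>1\<cdots>T\<^sub>m\<close>. The braid relation gives \<open>U (R\<^sub>m \<otimes> 1) = (1 \<otimes> R\<^sub>m) U\<close>; together with
  \<open>R\<^bsub>m+1\<^esub> = R\<^sub>m \<otimes> 1 + U = 1 + T\<^sub>1 (1 \<otimes> R\<^sub>m)\<close> this yields the factorization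
  \<open>R\<^bsub>m+1\<^esub> (1 - U) = (1 - T\<^sub>1 U) (R\<^sub>m \<otimes> 1)\<close>. As \<open>1 - U\<close> is bijective (injective in finite dimension)
  and \<open>1 - T\<^sub>1 U\<close> is injective, \<open>ker R\<^bsub>m+1\<^esub> = (1 - U) (ker R\<^sub>m \<otimes> \<H>)\<close>.

  In the Wick algebra \<open>a\<^sub>i\<^sup>* x = A\<^sub>i x + \<Sum>\<^sub>m (B\<^sub>i\<^sub>m x) a\<^sub>m\<^sup>*\<close> for \<open>x\<close> of degree \<open>n\<close>, where
  \<open>\<Sum>\<^sub>i e\<^sub>i \<otimes> A\<^sub>i x = R\<^sub>n x\<close> and \<open>\<Sum>\<^sub>i e\<^sub>i \<otimes> B\<^sub>i\<^sub>m x = T\<^sub>1\<cdots>T\<^sub>n (x \<otimes> e\<^sub>m)\<close>. On \<open>ker R\<^sub>n\<close> all \<open>A\<^sub>i\<close> vanish, and by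
  the braid relation the \<open>B\<^sub>i\<^sub>m\<close> map \<open>ker R\<^sub>n\<close> to itself, so it generates a Wick ideal. Conversely,
  if \<open>x\<close> of degree \<open>n\<close> lies in a Wick ideal \<open>I\<close> generated in degree \<open>n\<close>, apply
  \<open>a\<^sub>i\<^sup>* x \<in> I \<otimes> \<T>(\<H>\<^sup>*)\<close> to the vacuum of the Fock representation: \<open>A\<^sub>i x\<close> has degree \<open>n - 1\<close> but lies in \<open>I\<close>,
  whose elements have no components of degree less than \<open>n\<close>. Hence \<open>A\<^sub>i x = 0\<close> for all \<open>i\<close>, that is, \<open>R\<^sub>n x = 0\<close>.
\<close>


section \<open>Linear algebra on tensor powers\<close>

abbreviation clinear :: "('a free_alg \<Rightarrow> 'b free_alg) \<Rightarrow> bool" where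
  "clinear \<equiv> Vector_Spaces.linear cscale cscale"

interpretation cpair: vector_space_pair cscale cscale ..

lemma clinearI:
  assumes "\<And>x y. f (x + y) = f x + f y" "\<And>c x. f (cscale c x) = cscale c (f x)"
  shows "clinear f"
  by unfold_locales (simp_all add: assms)

lemma cscale_mult_left [simp]: "cscale c x * y = cscale c (x * y)"
  by (simp add: cscale_conv_mult mult.assoc)

lemma single_Nil_commute: "Poly_Mapping.single 0 c * x = x * Poly_Mapping.single 0 c" for x :: "'a free_alg"
  by (induction x rule: free_alg_induct) (simp_all add: mult_single algebra_simps)

lemma cscale_mult_right [simp]: "x * cscale c y = cscale c (x * y)"
  by (metis cscale_conv_mult mult.assoc single_Nil_commute)

named_theorems clinear_intros

text \<open>The operator is applied to \<open>f x\<close> for a linear \<open>f\<close> rather than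
  to \<open>x\<close>. Rules of this form prove linearity of nested expressions by repeated
  introduction, ending with \<open>clinear_ident\<close>.\<close>

lemma clinear_lin_ext [clinear_intros]: "clinear f \<Longrightarrow> clinear (\<lambda>x. lin_ext g (f x))"
  by (intro clinearI) (simp_all add: cpair.linear_add cpair.linear_scale lin_ext_add lin_ext_cscale)

lemma clinear_mult_left [clinear_intros]: "clinear f \<Longrightarrow> clinear (\<lambda>x. f x * y)"
  by (intro clinearI) (simp_all add: cpair.linear_add cpair.linear_scale algebra_simps)

lemma clinear_mult_right [clinear_intros]: "clinear f \<Longrightarrow> clinear (\<lambda>x. y * f x)"
  by (intro clinearI) (simp_all add: cpair.linear_add cpair.linear_scale algebra_simps)

lemma clinear_sum [clinear_intros]: "(\<And>i. clinear (f i)) \<Longrightarrow> clinear (\<lambda>x. \<Sum>i\<in>I. f i x)"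
  by (rule cpair.linear_compose_sum) simp

lemma clinear_cscale [clinear_intros]: "clinear f \<Longrightarrow> clinear (\<lambda>x. cscale c (f x))"
  by (rule cpair.linear_compose_scale_right)

lemmas [clinear_intros] = cpair.linear_compose_add cpair.linear_compose_sub

lemma clinear_ident [clinear_intros]: "clinear (\<lambda>x. x)"
  by (rule clinearI) simp_all

lemma clinear_T_at [clinear_intros]: "clinear f \<Longrightarrow> clinear (\<lambda>x. T_at T i (f x))"
  unfolding T_at_def by (rule clinear_lin_ext)

lemma clinear_T_prod [clinear_intros]: "clinear f \<Longrightarrow> clinear (\<lambda>x. T_prod T k (f x))"
  by (induction k arbitrary: f) (auto intro: clinear_intros)

lemma clinear_R_op [clinear_intros]: "clinear f \<Longrightarrow> clinear (\<lambda>x. R_op T n (f x))"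
  unfolding R_op_def by (intro clinear_intros)

section \<open>Tensor powers as spans of words\<close>

lemma free_alg_expand:
  "x = (\<Sum>w\<in>Poly_Mapping.keys x. cscale (Poly_Mapping.lookup x w) (word_monom w))"
  by (rule poly_mapping_eqI)
     (auto simp: lookup_sum word_monom_def lookup_single when_def in_keys_iff if_distrib sum.delta cong: if_cong)

lemma subspace_tpow: "cvec.subspace (tpow n)"
  by (auto simp: cvec.subspace_def tpow_def in_keys_iff lookup_add)

lemmas tpow_closed [simp] =
  cvec.subspace_0[OF subspace_tpow] cvec.subspace_add[OF subspace_tpow]
  cvec.subspace_diff[OF subspace_tpow] cvec.subspace_scale[OF subspace_tpow]
  cvec.subspace_sum[OF subspace_tpow]

lemma word_monom_tpow: "length w = n \<Longrightarrow> word_monom w \<in> tpow n"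
  by (simp add: tpow_def word_monom_def)

lemma span_words_tpow: "cvec.span (word_monom ` {w. length w = n}) = (tpow n :: 'a free_alg set)"
proof
  show "cvec.span (word_monom ` {w. length w = n}) \<subseteq> (tpow n :: 'a free_alg set)"
    by (rule cvec.span_minimal) (auto simp: word_monom_tpow subspace_tpow)
  show "(tpow n :: 'a free_alg set) \<subseteq> cvec.span (word_monom ` {w. length w = n})"
  proof
    fix x :: "'a free_alg" assume x: "x \<in> tpow n"
    have "cscale (Poly_Mapping.lookup x w) (word_monom w)
        \<in> cvec.span (word_monom ` {w. length w = n})" if "w \<in> Poly_Mapping.keys x" for w
      using that x by (intro cvec.span_scale cvec.span_base) (auto simp: tpow_def)
    then have "(\<Sum>w\<in>Poly_Mapping.keys x. cscale (Poly_Mapping.lookup x w) (word_monom w))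
        \<in> cvec.span (word_monom ` {w. length w = n})"
      by (rule cvec.span_sum)
    then show "x \<in> cvec.span (word_monom ` {w. length w = n})"
      by (simp flip: free_alg_expand)
  qed
qed

lemma span_words: "cvec.span (range word_monom) = (UNIV :: 'a free_alg set)"
proof -
  have "x \<in> cvec.span (range word_monom)" for x :: "'a free_alg"
    by (subst free_alg_expand[of x]) (intro cvec.span_sum cvec.span_scale cvec.span_base rangeI)
  then show ?thesis by blast
qed

text \<open>Words of length \<open>n\<close> span \<open>tpow n\<close>. Most operator identities
  below are reduced to words through this rule or its degree-free variant
  \<open>clinear_eq\<close>.\<close>

lemma clinear_eq_on_tpow:
  assumes "clinear f" "clinear g" "\<And>w. length w = n \<Longrightarrow> f (word_monom w) = g (word_monom w)"
    and "x \<in> tpow n"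
  shows "f x = g x"
  using cpair.linear_eq_on[OF assms(1,2), of x "word_monom ` {w. length w = n}"] assms(3,4)
  by (auto simp: span_words_tpow)

lemma clinear_eq:
  assumes "clinear f" "clinear g" "\<And>w. f (word_monom w) = g (word_monom w)"
  shows "f x = g x"
  using cpair.linear_eq_on[OF assms(1,2), of x "range word_monom"] assms(3)
  by (auto simp: span_words)

lemma clinear_mem_on_tpow:
  assumes "clinear f" "cvec.subspace S" "\<And>w. length w = n \<Longrightarrow> f (word_monom w) \<in> S" "x \<in> tpow n"
  shows "f x \<in> S"
proof -
  have "cvec.subspace (f -` S)"
    using cpair.linear_subspace_vimage[OF assms(1,2)] .
  then have "cvec.span (word_monom ` {w. length w = n}) \<subseteq> f -` S"
    by (intro cvec.span_minimal) (use assms(3) in auto)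
  with assms(4) show ?thesis by (auto simp: span_words_tpow)
qed

lemma tpow_mult:
  assumes "x \<in> tpow m" "y \<in> tpow n"
  shows "x * y \<in> tpow (m + n)"
proof (rule clinear_mem_on_tpow[where f = "\<lambda>x. x * y", OF _ subspace_tpow _ assms(1)])
  fix v :: "'a list" assume "length v = m"
  then show "word_monom v * y \<in> tpow (m + n)"
    by (intro clinear_mem_on_tpow[where f = "\<lambda>y. word_monom v * y", OF _ subspace_tpow _ assms(2)])
       (auto simp: word_monom_mult intro!: clinear_intros word_monom_tpow)
qed (intro clinear_intros)

section \<open>Splitting off the first or the last tensor factor\<close>

lemma lookup_word_monom_mult:
  "Poly_Mapping.lookup (word_monom u * x) v
     = (if take (length u) v = u then Poly_Mapping.lookup x (drop (length u) v) else 0)"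
proof (induction x rule: free_alg_induct)
  case (single w c)
  have "(take (length u) v = u \<and> drop (length u) v = w) \<longleftrightarrow> u @ w = v"
    by (metis append_eq_conv_conj)
  then show ?case
    by (auto simp: word_monom_def mult_single plus_list_def lookup_single when_def)
qed (simp_all add: algebra_simps lookup_add)

lemma lookup_mult_word_monom:
  "Poly_Mapping.lookup (x * word_monom u) (v @ u) = Poly_Mapping.lookup x v"
  "length t = length u \<Longrightarrow> t \<noteq> u \<Longrightarrow> Poly_Mapping.lookup (x * word_monom u) (v @ t) = 0"
  by (induction x rule: free_alg_induct)
     (auto simp: word_monom_def mult_single plus_list_def lookup_single when_def algebra_simps lookup_add)

text \<open>The coefficient of \<open>i # w\<close> in the sum comes from the summand with index
  \<open>i\<close> alone and equals the coefficient of \<open>w\<close> in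
  \<open>f i\<close>.\<close>

lemma sum_gen_mult_eq_0:
  fixes f :: "'d::finite \<Rightarrow> 'd free_alg"
  assumes "(\<Sum>i\<in>UNIV. word_monom [i] * f i) = 0"
  shows "f i = 0"
proof (rule poly_mapping_eqI)
  fix w
  have "0 = Poly_Mapping.lookup (\<Sum>i\<in>UNIV. word_monom [i] * f i) (i # w)"
    by (simp add: assms)
  also have "\<dots> = (\<Sum>j\<in>UNIV. if j = i then Poly_Mapping.lookup (f j) w else 0)"
    by (simp add: lookup_sum lookup_word_monom_mult eq_commute cong: if_cong)
  finally show "Poly_Mapping.lookup (f i) w = Poly_Mapping.lookup 0 w" by simp
qed

lemma sum_mult_gen_eq_0:
  fixes f :: "'d::finite \<Rightarrow> 'd free_alg"
  assumes "(\<Sum>i\<in>UNIV. f i * word_monom [i]) = 0"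
  shows "f i = 0"
proof (rule poly_mapping_eqI)
  fix w
  have "0 = Poly_Mapping.lookup (\<Sum>i\<in>UNIV. f i * word_monom [i]) (w @ [i])"
    by (simp add: assms)
  also have "\<dots> = (\<Sum>j\<in>UNIV. if j = i then Poly_Mapping.lookup (f j) w else 0)"
    unfolding lookup_sum by (intro sum.cong) (auto simp: lookup_mult_word_monom)
  finally show "Poly_Mapping.lookup (f i) w = Poly_Mapping.lookup 0 w" by simp
qed

lemma tpow_Suc_expand:
  fixes x :: "('d::finite) free_alg"
  assumes "x \<in> tpow (Suc m)"
  obtains f where "\<And>i. f i \<in> tpow m" "x = (\<Sum>i\<in>UNIV. f i * word_monom [i])"
proof -
  let ?S = "{\<Sum>i\<in>UNIV. f i * word_monom [i] | f. \<forall>i::'d. f i \<in> tpow m}"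
  have "cvec.subspace ?S"
  proof (rule cvec.subspaceI)
    show "0 \<in> ?S" by (auto intro!: exI[of _ "\<lambda>_. 0"])
    show "a + b \<in> ?S" if "a \<in> ?S" "b \<in> ?S" for a b
    proof -
      from that obtain f g where "\<forall>i. f i \<in> tpow m" "a = (\<Sum>i\<in>UNIV. f i * word_monom [i])"
        "\<forall>i. g i \<in> tpow m" "b = (\<Sum>i\<in>UNIV. g i * word_monom [i])" by blast
      then show ?thesis
        by (auto intro!: exI[of _ "\<lambda>i. f i + g i"] simp: algebra_simps sum.distrib)
    qed
    show "cscale c a \<in> ?S" if "a \<in> ?S" for c a
    proof -
      from that obtain f where "\<forall>i. f i \<in> tpow m" "a = (\<Sum>i\<in>UNIV. f i * word_monom [i])"
        by blast
      then show ?thesis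
        by (auto intro!: exI[of _ "\<lambda>i. cscale c (f i)"] simp: cvec.scale_sum_right)
    qed
  qed
  moreover have "word_monom w \<in> ?S" if len: "length w = Suc m" for w :: "'d list"
  proof -
    obtain u k where w: "w = u @ [k]" "length u = m"
      using len by (metis length_Suc_conv_rev)
    show ?thesis
      \<comment> \<open>The witness is the family supported at the last letter \<open>k\<close>,
        where its value is the word without that letter.\<close>
      using w by (auto intro!: exI[of _ "\<lambda>i. if i = k then word_monom u else 0"]
        simp: word_monom_mult word_monom_tpow if_distrib[of "\<lambda>t. t * _"] cong: if_cong)
  qed
  ultimately have "x \<in> ?S"
    using clinear_mem_on_tpow[where f = "\<lambda>x. x", OF clinear_ident _ _ assms] by blast
  with that show thesis by blast
qed

text \<open>The whole algebra is infinite dimensional, so the dimension count takes place in the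
  span of finitely many words. The image of a basis is independent and of the same size; a vector
  outside its span would enlarge it to an independent set with more elements than the basis.\<close>

lemma clinear_inj_surj_tpow:
  fixes f :: "('d::finite) free_alg \<Rightarrow> 'd free_alg"
  assumes f: "clinear f" and maps: "\<And>x. x \<in> tpow n \<Longrightarrow> f x \<in> tpow n"
    and ker: "\<And>x. x \<in> tpow n \<Longrightarrow> f x = 0 \<Longrightarrow> x = 0"
  shows "f ` tpow n = tpow n"
proof
  let ?B = "word_monom ` {w::'d list. length w = n}"
  have fin: "finite ?B"
    using finite_lists_length_eq[of "UNIV :: 'd set" n] by simp
  obtain B where B: "B \<subseteq> ?B" "cvec.independent B" "cvec.span B = tpow n"
    using cvec.maximal_independent_subset[of ?B] cvec.span_eq cvec.span_mono span_words_tpow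
    by (metis cvec.span_minimal cvec.subspace_span subset_antisym)
  have finB: "finite B" using B(1) fin finite_subset by blast
  have inj: "inj_on f (cvec.span B)"
    by (subst cpair.linear_inj_on_iff_eq_0[OF f cvec.subspace_span]) (use ker B(3) in auto)
  have ind: "cvec.independent (f ` B)"
    using cpair.linear_independent_injective_image[OF f B(2) inj] .
  have card: "card (f ` B) = card B"
    using inj by (meson card_image cvec.span_superset inj_on_subset)
  show "tpow n \<subseteq> f ` tpow n"
  proof
    fix y :: "'d free_alg" assume y: "y \<in> tpow n"
    have "y \<in> cvec.span (f ` B)"
    proof (rule ccontr)
      assume n: "y \<notin> cvec.span (f ` B)"
      then have "cvec.independent (insert y (f ` B))"
        using ind cvec.independent_insertI by blast
      moreover have "insert y (f ` B) \<subseteq> cvec.span B"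
        using y maps B(3) cvec.span_superset[of B] by auto
      ultimately have "card (insert y (f ` B)) \<le> card B"
        using cvec.independent_span_bound[OF finB] by blast
      moreover have "y \<notin> f ` B" using n cvec.span_base by blast
      ultimately show False using card finB by simp
    qed
    then show "y \<in> f ` tpow n"
      using cpair.linear_span_image[OF f, of B] B(3) by simp
  qed
qed (use maps in auto)


section \<open>The braid relation and the kernels of \<open>R\<^sub>n\<close>\<close>

lemma T_at_word:
  "T_at T i (word_monom w)
     = word_monom (take (i - 1) w) * T_basis T (w ! (i - 1)) (w ! i) * word_monom (drop (i + 1) w)"
  by (simp add: T_at_def)

lemma T_basis_tpow: "T_basis T k l \<in> tpow 2"
  unfolding T_basis_def by (intro tpow_closed word_monom_tpow) simp

lemma T_at_tpow:
  assumes "1 \<le> i" "i < n" "x \<in> tpow n"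
  shows "T_at T i x \<in> tpow n"
proof (rule clinear_mem_on_tpow[where f = "T_at T i", OF _ subspace_tpow _ assms(3)])
  fix w :: "'a list" assume len: "length w = n"
  have "word_monom (take (i - 1) w) * T_basis T (w ! (i - 1)) (w ! i) * word_monom (drop (i + 1) w)
    \<in> tpow ((i - 1) + 2 + (n - (i + 1)))"
    using len assms by (intro tpow_mult T_basis_tpow word_monom_tpow) auto
  then show "T_at T i (word_monom w) \<in> tpow n"
    using assms by (simp add: T_at_word)
qed (intro clinear_intros)

lemma T_at_word_append_left:
  assumes "1 \<le> i" "length u = p"
  shows "T_at T (p + i) (word_monom u * word_monom w) = word_monom u * T_at T i (word_monom w)"
proof -
  have "(u @ w) ! (p + i - 1) = w ! (i - 1)" "(u @ w) ! (p + i) = w ! i"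
    "take (p + i - 1) (u @ w) = u @ take (i - 1) w" "drop (p + i + 1) (u @ w) = drop (i + 1) w"
    using assms by (auto simp: nth_append)
  then show ?thesis
    unfolding word_monom_mult T_at_word by (simp only: mult.assoc flip: word_monom_mult)
qed

text \<open>The left factor occupies the first \<open>p\<close> positions, so position
  \<open>p + i\<close> of the product is position \<open>i\<close> of \<open>y\<close>. Here
  \<open>y\<close> may be of mixed degree: an index beyond the end of a word is shifted in the same
  way.\<close>

lemma T_at_mult_left:
  assumes "1 \<le> i" "x \<in> tpow p"
  shows "T_at T (p + i) (x * y) = x * T_at T i y"
proof (rule clinear_eq_on_tpow[where f = "\<lambda>x. T_at T (p + i) (x * y)", OF _ _ _ assms(2)])
  fix u :: "'a list" assume len: "length u = p"
  show "T_at T (p + i) (word_monom u * y) = word_monom u * T_at T i y"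
    by (rule clinear_eq[where x = y and f = "\<lambda>y. T_at T (p + i) (word_monom u * y)"])
       (intro clinear_intros T_at_word_append_left assms(1) len)+
qed (intro clinear_intros)+

lemma T_at_word_append_right:
  assumes "i < length u"
  shows "T_at T i (word_monom u * word_monom w) = T_at T i (word_monom u) * word_monom w"
proof -
  have "(u @ w) ! (i - 1) = u ! (i - 1)" "(u @ w) ! i = u ! i"
    "take (i - 1) (u @ w) = take (i - 1) u" "drop (i + 1) (u @ w) = drop (i + 1) u @ w"
    using assms by (auto simp: nth_append)
  then show ?thesis
    unfolding word_monom_mult T_at_word by (simp only: mult.assoc flip: word_monom_mult)
qed

lemma T_at_mult_right:
  assumes "i < m" "x \<in> tpow m"
  shows "T_at T i (x * y) = T_at T i x * y"
proof (rule clinear_eq_on_tpow[where f = "\<lambda>x. T_at T i (x * y)", OF _ _ _ assms(2)])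
  fix u :: "'a list" assume "length u = m"
  with assms(1) have len: "i < length u" by simp
  show "T_at T i (word_monom u * y) = T_at T i (word_monom u) * y"
    by (rule clinear_eq[where x = y and f = "\<lambda>y. T_at T i (word_monom u * y)"])
       (intro clinear_intros T_at_word_append_right len)+
qed (intro clinear_intros)+

lemma T_at_commute:
  assumes "1 \<le> i" "i + 2 \<le> j" "x \<in> tpow n" "j < n"
  shows "T_at T i (T_at T j x) = T_at T j (T_at T i x)"
proof (rule clinear_eq_on_tpow[where f = "\<lambda>x. T_at T i (T_at T j x)", OF _ _ _ assms(3)])
  fix w :: "'a list" assume len: "length w = n"
  define u v where "u = (word_monom (take (i + 1) w) :: 'a free_alg)"
    and "v = (word_monom (drop (i + 1) w) :: 'a free_alg)"
  \<comment> \<open>The word is cut after letter \<open>i + 1\<close>, so T_i acts on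
    \<open>u\<close> only. T_j acts on \<open>v\<close> only, where its position counts from the
    cut.\<close>
  define p where "p = j - (i + 1)"
  have j: "j = (i + 1) + p" "1 \<le> p" using assms by (auto simp: p_def)
  have w: "word_monom w = u * v" by (simp add: u_def v_def word_monom_mult)
  have u: "u \<in> tpow (i + 1)" unfolding u_def by (rule word_monom_tpow) (use len assms in auto)
  have Tu: "T_at T i u \<in> tpow (i + 1)" using u assms by (intro T_at_tpow) auto
  have "T_at T i (T_at T j (u * v)) = T_at T i u * T_at T p v"
    using T_at_mult_left[OF j(2) u] T_at_mult_right[OF _ u] j(1) by simp
  also have "\<dots> = T_at T j (T_at T i (u * v))"
    using u Tu j by (simp add: T_at_mult_right[of i "i + 1"] T_at_mult_left del: One_nat_def)
  finally show "T_at T i (T_at T j (word_monom w)) = T_at T j (T_at T i (word_monom w))"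
    by (simp add: w)
qed (intro clinear_intros)+

lemma braid_shifted:
  assumes "braided T" "1 \<le> i" "i + 1 < n" "x \<in> tpow n"
  shows "T_at T i (T_at T (i + 1) (T_at T i x)) = T_at T (i + 1) (T_at T i (T_at T (i + 1) x))"
proof (rule clinear_eq_on_tpow[where f = "\<lambda>x. T_at T i (T_at T (i + 1) (T_at T i x))", OF _ _ _ assms(4)])
  fix w :: "'a list" assume len: "length w = n"
  define p where "p = i - 1"
  have i: "i = p + 1" using assms by (simp add: p_def)
  \<comment> \<open>The middle piece \<open>v\<close> consists of the three letters touched by T_i
    and T_(i+1). On it these operators act as T_1 and T_2, which reduces the claim to the braid
    relation in degree 3.\<close>
  define u v t where "u = (word_monom (take p w) :: 'a free_alg)"
    and "v = (word_monom (take 3 (drop p w)) :: 'a free_alg)"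
    and "t = (word_monom (drop (p + 3) w) :: 'a free_alg)"
  have "w = take p w @ take 3 (drop p w) @ drop (p + 3) w"
    by (metis append_take_drop_id drop_drop add.commute)
  then have w: "word_monom w = u * (v * t)" by (simp add: u_def v_def t_def word_monom_mult)
  have u: "u \<in> tpow p" unfolding u_def by (rule word_monom_tpow) (use len assms i in auto)
  have v: "v \<in> tpow 3" unfolding v_def by (rule word_monom_tpow) (use len assms i in auto)
  have 1: "T_at T i (u * (y * t)) = u * (T_at T 1 y * t)" if "y \<in> tpow 3" for y
    unfolding i T_at_mult_left[OF order_refl u] using that by (simp add: T_at_mult_right[of _ 3])
  have i1: "i + 1 = p + 2" using i by simp
  have 2: "T_at T (i + 1) (u * (y * t)) = u * (T_at T 2 y * t)" if "y \<in> tpow 3" for y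
    unfolding i1 T_at_mult_left[OF one_le_numeral u] using that by (simp add: T_at_mult_right[of _ 3])
  have tp: "T_at T 1 y \<in> tpow 3" "T_at T 2 y \<in> tpow 3" if "y \<in> tpow 3" for y
    using that by (auto intro!: T_at_tpow)
  show "T_at T i (T_at T (i + 1) (T_at T i (word_monom w))) = T_at T (i + 1) (T_at T i (T_at T (i + 1) (word_monom w)))"
    using assms(1) v unfolding w braided_def by (simp add: 1 2 v tp del: One_nat_def)
qed (intro clinear_intros)+

section \<open>Intertwining relations for the products T_1 ... T_k\<close>

lemma T_prod_tpow: "k < n \<Longrightarrow> x \<in> tpow n \<Longrightarrow> T_prod T k x \<in> tpow n"
  by (induction k arbitrary: x) (simp_all add: T_at_tpow)

lemma T_prod_mult_right:
  "k < m \<Longrightarrow> x \<in> tpow m \<Longrightarrow> T_prod T k (x * y) = T_prod T k x * y"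
  by (induction k arbitrary: x) (auto simp: T_at_mult_right T_at_tpow)

lemma T_prod_commute:
  "k + 2 \<le> j \<Longrightarrow> j < n \<Longrightarrow> x \<in> tpow n \<Longrightarrow> T_prod T k (T_at T j x) = T_at T j (T_prod T k x)"
  by (induction k arbitrary: x) (auto simp: T_at_commute[of _ j x n for x] T_at_tpow)

text \<open>Moving to the left, T_i commutes with T_m, ..., T_(i+2). The braid relation then turns
  T_i T_(i+1) T_i into T_(i+1) T_i T_(i+1), and the new leading T_(i+1) commutes with T_(i-1), ...,
  T_1. The induction on \<open>m\<close> treats the last factor of the product.\<close>

lemma T_prod_T_at:
  assumes T: "braided T"
  shows "1 \<le> i \<Longrightarrow> i < m \<Longrightarrow> m < n \<Longrightarrow> x \<in> tpow n \<Longrightarrow>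
    T_prod T m (T_at T i x) = T_at T (Suc i) (T_prod T m x)"
proof (induction m arbitrary: x)
  case (Suc m)
  show ?case
  proof (cases "i < m")
    case True
    then show ?thesis
      using Suc by (simp add: T_at_commute[symmetric] T_at_tpow)
  next
    case False
    with Suc.prems have i: "i = m" by simp
    \<comment> \<open>Since \<open>1 \<le> i\<close>, the product T_1 ... T_m is not empty and ends
      with the factor T_m that the braid relation needs.\<close>
    with Suc.prems obtain k where m: "m = Suc k" by (cases m) auto
    have "T_prod T (Suc m) (T_at T i x) = T_prod T k (T_at T m (T_at T (m + 1) (T_at T m x)))"
      by (simp add: i m)
    also have "\<dots> = T_prod T k (T_at T (m + 1) (T_at T m (T_at T (m + 1) x)))"
      using Suc.prems m by (subst braid_shifted[OF T, of _ n]) auto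
    also have "\<dots> = T_at T (m + 1) (T_prod T k (T_at T m (T_at T (m + 1) x)))"
      using Suc.prems m by (intro T_prod_commute[of _ _ n] T_at_tpow) auto
    finally show ?thesis by (simp add: i m)
  qed
qed simp

text \<open>\<open>T_prod_tail T k\<close> is \<open>T\<^sub>2\<cdots>T\<^bsub>k+1\<^esub>\<close>, that is, \<open>1 \<otimes> T\<^sub>1\<cdots>T\<^sub>k\<close>.\<close>

primrec T_prod_tail :: "('d::finite) coeffs \<Rightarrow> nat \<Rightarrow> 'd free_alg \<Rightarrow> 'd free_alg" where
  "T_prod_tail T 0 = id"
| "T_prod_tail T (Suc k) = T_prod_tail T k \<circ> T_at T (Suc (Suc k))"

text \<open>The recursion of \<open>T_prod\<close> strips factors on the right. Stripping T_1 on the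
  left instead is what inductions on the first letter of a word require.\<close>

lemma T_prod_Suc_tail: "T_prod T (Suc k) x = T_at T 1 (T_prod_tail T k x)"
  by (induction k arbitrary: x) simp_all

lemma T_prod_tail_mult_left:
  "u \<in> tpow 1 \<Longrightarrow> T_prod_tail T k (u * x) = u * T_prod T k x"
  by (induction k arbitrary: x) (use T_at_mult_left[of "Suc k" u 1 T x for k x] in simp_all)

lemma T_prod_T_prod:
  assumes "braided T" "m < n"
  shows "k < m \<Longrightarrow> x \<in> tpow n \<Longrightarrow> T_prod T m (T_prod T k x) = T_prod_tail T k (T_prod T m x)"
proof (induction k arbitrary: x)
  case (Suc k)
  then show ?case
    using assms by (simp add: T_at_tpow T_prod_T_at)
qed simp

section \<open>Two decompositions of R_(m+1) and the recursion for its kernel\<close>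

lemma R_op_Suc: "R_op T (Suc m) x = R_op T m x + T_prod T m x"
  by (simp add: R_op_def)

lemma R_op_Suc_tail: "R_op T (Suc m) x = x + T_at T 1 (\<Sum>k<m. T_prod_tail T k x)"
proof -
  have "clinear (T_at T 1)" by (intro clinear_intros)
  then show ?thesis
    by (simp only: R_op_def sum.lessThan_Suc_shift T_prod_Suc_tail cpair.linear_sum) simp
qed

lemma R_op_mult_right: "x \<in> tpow m \<Longrightarrow> R_op T m (x * y) = R_op T m x * y"
  by (simp add: R_op_def T_prod_mult_right sum_distrib_right)

text \<open>Summing \<open>T_prod_T_prod\<close> over \<open>k\<close> gives (1 \<otimes> R_m) U = U
  (R_m \<otimes> 1) with U = T_1 ... T_m. In degree above \<open>m\<close>, \<open>R_op T m\<close>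
  acts on the first \<open>m\<close> factors and is the identity on the others.\<close>

lemma T_prod_R_op:
  assumes "braided T" "m < n" "x \<in> tpow n"
  shows "(\<Sum>k<m. T_prod_tail T k (T_prod T m x)) = T_prod T m (R_op T m x)"
proof -
  have "clinear (T_prod T m)" by (intro clinear_intros)
  then show ?thesis using assms by (simp add: R_op_def cpair.linear_sum T_prod_T_prod)
qed

text \<open>The two decompositions serve different arguments: R_m \<otimes> 1 + U is applied to
  \<open>x\<close>, and 1 + T_1 (1 \<otimes> R_m) to U \<open>x\<close>. The two copies of U
  \<open>x\<close> cancel.\<close>

lemma R_op_Suc_factor:
  assumes "braided T" "x \<in> tpow (m + 1)"
  shows "R_op T (m + 1) (x - T_prod T m x) = R_op T m x - T_at T 1 (T_prod T m (R_op T m x))"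
proof -
  have "clinear (R_op T (m + 1))" by (intro clinear_intros)
  then have "R_op T (m + 1) (x - T_prod T m x) = R_op T (m + 1) x - R_op T (m + 1) (T_prod T m x)"
    by (rule cpair.linear_diff)
  also have "R_op T (m + 1) (T_prod T m x) = T_prod T m x + T_at T 1 (T_prod T m (R_op T m x))"
    using assms by (simp add: R_op_Suc_tail T_prod_R_op[of T m "Suc m"])
  finally show ?thesis by (simp add: R_op_Suc)
qed

lemma subspace_ker_on: "clinear f \<Longrightarrow> cvec.subspace (ker_on n f)"
  by (auto intro!: cvec.subspaceI simp: ker_on_def cpair.linear_0 cpair.linear_add cpair.linear_scale)

text \<open>In degree \<open>m + 1\<close> the operator \<open>R_op T m\<close> is R_m \<otimes> 1.
  Expanding by the last letter, it kills an element exactly when R_m kills every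
  coefficient.\<close>

lemma tensor_ker_on:
  "tensor (ker_on m (R_op T m)) (tpow 1) = ker_on (m + 1) (R_op T m)"
proof
  show "tensor (ker_on m (R_op T m)) (tpow 1) \<subseteq> ker_on (m + 1) (R_op T m)"
    unfolding tensor_def
    by (intro cvec.span_minimal subspace_ker_on clinear_intros)
       (auto simp: ker_on_def R_op_mult_right intro: tpow_mult[where n = 1, simplified])
  show "ker_on (m + 1) (R_op T m) \<subseteq> tensor (ker_on m (R_op T m)) (tpow 1)"
  proof
    fix x assume "x \<in> ker_on (m + 1) (R_op T m)"
    then have x: "x \<in> tpow (Suc m)" "R_op T m x = 0" by (auto simp: ker_on_def)
    obtain f where f: "\<And>i. f i \<in> tpow m" "x = (\<Sum>i\<in>UNIV. f i * word_monom [i])"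
      using tpow_Suc_expand[OF x(1)] by blast
    have "clinear (R_op T m)" by (intro clinear_intros)
    then have "(\<Sum>i\<in>UNIV. R_op T m (f i) * word_monom [i]) = 0"
      using x(2) f by (simp add: cpair.linear_sum R_op_mult_right)
    from sum_mult_gen_eq_0[OF this] have "f i \<in> ker_on m (R_op T m)" for i
      using f(1) by (auto simp: ker_on_def)
    then show "x \<in> tensor (ker_on m (R_op T m)) (tpow 1)"
      unfolding f(2) tensor_def
      by (intro cvec.span_sum cvec.span_base) (use word_monom_tpow[of "[_]" 1] in force)
  qed
qed

lemma ker_R_op_Suc:
  assumes T: "braided T"
    and ker1: "ker_on (m + 1) (\<lambda>x. x - T_prod T m x) = {0}"
    and ker2: "ker_on (m + 1) (\<lambda>x. x - T_at T 1 (T_prod T m x)) = {0}"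
  shows "ker_on (m + 1) (R_op T (m + 1)) = (\<lambda>x. x - T_prod T m x) ` ker_on (m + 1) (R_op T m)"
proof -
  let ?f = "\<lambda>x. x - T_prod T m x"
  have R: "R_op T m x \<in> tpow (m + 1)" if "x \<in> tpow (m + 1)" for x
    using that unfolding R_op_def by (intro tpow_closed T_prod_tpow) auto
  \<comment> \<open>Finite dimension turns injectivity of 1 - U into surjectivity, so every element
    of the kernel has the form \<open>?f x\<close>.\<close>
  have surj: "?f ` tpow (m + 1) = tpow (m + 1)"
  proof (rule clinear_inj_surj_tpow)
    show "clinear ?f" by (intro clinear_intros)
    show "?f x \<in> tpow (m + 1)" if "x \<in> tpow (m + 1)" for x
      using that by (intro tpow_closed T_prod_tpow) auto
    show "x = 0" if "x \<in> tpow (m + 1)" "?f x = 0" for x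
      using ker1 that by (auto simp only: ker_on_def)
  qed
  \<comment> \<open>The injective operator 1 - T_1 U cancels from the factorization of R_(m+1) (1 -
    U).\<close>
  have iff: "R_op T (m + 1) (?f x) = 0 \<longleftrightarrow> R_op T m x = 0" if x: "x \<in> tpow (m + 1)" for x
  proof
    assume "R_op T (m + 1) (?f x) = 0"
    then have "R_op T m x \<in> ker_on (m + 1) (\<lambda>x. x - T_at T 1 (T_prod T m x))"
      using x R by (simp only: R_op_Suc_factor[OF T] ker_on_def) auto
    then show "R_op T m x = 0" using ker2 by auto
  next
    have "clinear (\<lambda>x. x - T_at T 1 (T_prod T m x))" by (intro clinear_intros)
    from cpair.linear_0[OF this] show "R_op T (m + 1) (?f x) = 0" if "R_op T m x = 0"
      using that x by (simp only: R_op_Suc_factor[OF T])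
  qed
  show ?thesis
  proof (intro equalityI subsetI)
    fix y assume "y \<in> ker_on (m + 1) (R_op T (m + 1))"
    then have y: "y \<in> tpow (m + 1)" "R_op T (m + 1) y = 0" by (auto simp: ker_on_def)
    then obtain x where x: "x \<in> tpow (m + 1)" "y = ?f x" using surj by blast
    then show "y \<in> ?f ` ker_on (m + 1) (R_op T m)"
      using y(2) iff[OF x(1)] unfolding ker_on_def by blast
  next
    fix y assume "y \<in> ?f ` ker_on (m + 1) (R_op T m)"
    then obtain x where x: "x \<in> tpow (m + 1)" "R_op T m x = 0" "y = ?f x"
      by (auto simp: ker_on_def)
    then show "y \<in> ker_on (m + 1) (R_op T (m + 1))"
      using iff[OF x(1)] surj unfolding ker_on_def by blast
  qed
qed

lemma K_space_eq_ker_R_op: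
  assumes T: "braided T"
    and ker1: "\<And>m. m \<ge> 2 \<Longrightarrow> ker_on (m + 1) (\<lambda>x. x - T_prod T m x) = {0}"
    and ker2: "\<And>m. m \<ge> 2 \<Longrightarrow> ker_on (m + 1) (\<lambda>x. x - T_at T 1 (T_prod T m x)) = {0}"
  shows "m \<ge> 2 \<Longrightarrow> K_space T m = ker_on m (R_op T m)"
proof (induction m rule: nat_induct_at_least)
  case base
  \<comment> \<open>The value at 2 comes from the first branch of the recursion, taken with
    predecessor 1.\<close>
  show ?case by (simp add: numeral_2_eq_2)
next
  case (Suc m)
  then show ?case
    using ker_R_op_Suc[OF T ker1 ker2, of m] tensor_ker_on[of m T] by simp
qed


section \<open>Moving adjoint generators to the right\<close>

text \<open>
  \<open>annih\<close> and \<open>transit\<close> are the operators \<open>A\<^sub>i\<close> and \<open>B\<^sub>i\<^sub>m\<close>; the recursion moves \<open>a\<^sub>i\<^sup>*\<close> past one letter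
  by means of the Wick relation.
\<close>

primrec annih_word :: "('d::finite) coeffs \<Rightarrow> 'd list \<Rightarrow> 'd \<Rightarrow> 'd free_alg" where
  "annih_word T [] = (\<lambda>i. 0)"
| "annih_word T (j # w) = (\<lambda>i. (if i = j then word_monom w else 0) +
     (\<Sum>k\<in>UNIV. \<Sum>l\<in>UNIV. cscale (T i j k l) (word_monom [l] * annih_word T w k)))"

primrec transit_word :: "('d::finite) coeffs \<Rightarrow> 'd list \<Rightarrow> 'd \<Rightarrow> 'd \<Rightarrow> 'd free_alg" where
  "transit_word T [] = (\<lambda>i m. if i = m then 1 else 0)"
| "transit_word T (j # w) = (\<lambda>i m.
     (\<Sum>k\<in>UNIV. \<Sum>l\<in>UNIV. cscale (T i j k l) (word_monom [l] * transit_word T w k m)))"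

definition annih :: "('d::finite) coeffs \<Rightarrow> 'd \<Rightarrow> 'd free_alg \<Rightarrow> 'd free_alg" where
  "annih T i = lin_ext (\<lambda>w. annih_word T w i)"

definition transit :: "('d::finite) coeffs \<Rightarrow> 'd \<Rightarrow> 'd \<Rightarrow> 'd free_alg \<Rightarrow> 'd free_alg" where
  "transit T i m = lin_ext (\<lambda>w. transit_word T w i m)"

lemma clinear_annih [clinear_intros]: "clinear f \<Longrightarrow> clinear (\<lambda>x. annih T i (f x))"
  unfolding annih_def by (rule clinear_lin_ext)

lemma clinear_transit [clinear_intros]: "clinear f \<Longrightarrow> clinear (\<lambda>x. transit T i m (f x))"
  unfolding transit_def by (rule clinear_lin_ext)

lemma annih_word_monom [simp]: "annih T i (word_monom w) = annih_word T w i"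
  by (simp add: annih_def)

lemma transit_word_monom [simp]: "transit T i m (word_monom w) = transit_word T w i m"
  by (simp add: transit_def)

lemma annih_1 [simp]: "annih T i 1 = 0"
  by (simp flip: word_monom_Nil)

lemma transit_1 [simp]: "transit T i m 1 = (if i = m then 1 else 0)"
  using transit_word_monom[of T i m "[]"] by (simp add: word_monom_Nil)

lemma annih_gen_mult:
  "annih T i (word_monom [j] * x) = (if i = j then x else 0) +
     (\<Sum>k\<in>UNIV. \<Sum>l\<in>UNIV. cscale (T i j k l) (word_monom [l] * annih T k x))"
proof (rule clinear_eq[where f = "\<lambda>x. annih T i (word_monom [j] * x)"])
  have "clinear (\<lambda>x. if i = j then x else 0)"
    by (rule clinearI) simp_all
  then show "clinear (\<lambda>x. (if i = j then x else 0) +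
     (\<Sum>k\<in>UNIV. \<Sum>l\<in>UNIV. cscale (T i j k l) (word_monom [l] * annih T k x)))"
    by (intro clinear_intros)
qed (simp add: word_monom_mult | intro clinear_intros)+

lemma annih_tpow: "x \<in> tpow (Suc n) \<Longrightarrow> annih T i x \<in> tpow n"
proof (rule clinear_mem_on_tpow[where f = "annih T i", OF _ subspace_tpow])
  show "annih T i (word_monom w) \<in> tpow n" if "length w = Suc n" for w
    using that
  proof (induction w arbitrary: n i)
    case (Cons j w)
    have "word_monom [l] * annih_word T w k \<in> tpow n" for k l
    \<comment> \<open>For empty \<open>w\<close> the term is 0, which lies in every degree.
      Otherwise \<open>n\<close> is a successor and the induction hypothesis applies one degree
      lower.\<close>
    proof (cases w)
      case (Cons j' w')
      then obtain n' where n: "n = Suc n'" using Cons.prems by (cases n) auto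
      have "annih_word T w k \<in> tpow n'"
        using Cons.IH[of n' k] Cons.prems n by simp
      then show ?thesis
        using tpow_mult[of "word_monom [l]" 1 "annih_word T w k" n'] n
        by (simp add: word_monom_tpow)
    qed simp
    moreover have "(if i = j then word_monom w else 0) \<in> tpow n"
      using Cons.prems by (simp add: word_monom_tpow)
    ultimately show ?case by (auto intro!: tpow_closed)
  qed simp
qed (auto intro: clinear_intros)

lemma transit_tpow: "x \<in> tpow n \<Longrightarrow> transit T i m x \<in> tpow n"
proof (rule clinear_mem_on_tpow[where f = "transit T i m", OF _ subspace_tpow])
  show "transit T i m (word_monom w) \<in> tpow n" if "length w = n" for w
    using that
  proof (induction w arbitrary: n i m)
    case Nil
    then show ?case by (auto simp: word_monom_tpow simp flip: word_monom_Nil)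
  next
    case (Cons j w)
    then have "transit_word T w k m \<in> tpow (length w)" for k by simp
    then have "word_monom [l] * transit_word T w k m \<in> tpow n" for k l
      using tpow_mult[of "word_monom [l]" 1 "transit_word T w k m" "length w"] Cons.prems
      by (simp add: word_monom_tpow)
    then show ?case by (auto intro!: tpow_closed)
  qed
qed (auto intro: clinear_intros)

section \<open>Product rules for \<open>annih\<close> and \<open>transit\<close>\<close>

lemma sum_rotate:
  "(\<Sum>k\<in>A. \<Sum>l\<in>B. \<Sum>p\<in>C. f k l p) = (\<Sum>p\<in>C. \<Sum>k\<in>A. \<Sum>l\<in>B. f k l p)"
proof -
  have "(\<Sum>k\<in>A. \<Sum>l\<in>B. \<Sum>p\<in>C. f k l p) = (\<Sum>k\<in>A. \<Sum>p\<in>C. \<Sum>l\<in>B. f k l p)"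
    by (intro sum.cong refl sum.swap)
  also have "\<dots> = (\<Sum>p\<in>C. \<Sum>k\<in>A. \<Sum>l\<in>B. f k l p)"
    by (rule sum.swap)
  finally show ?thesis .
qed

text \<open>The adjoint with index \<open>i\<close> leaves \<open>x\<close> with some index
  \<open>k\<close> and then leaves \<open>y\<close> with index \<open>m\<close>; the transits thus
  multiply like matrices.\<close>

lemma transit_mult:
  "transit T i m (x * y) = (\<Sum>k\<in>UNIV. transit T i k x * transit T k m y)"
proof (rule clinear_eq[where x = x and f = "\<lambda>x. transit T i m (x * y)"])
  fix u
  show "transit T i m (word_monom u * y) = (\<Sum>k\<in>UNIV. transit T i k (word_monom u) * transit T k m y)"
  proof (rule clinear_eq[where x = y and f = "\<lambda>y. transit T i m (word_monom u * y)"])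
    fix v
    show "transit T i m (word_monom u * word_monom v)
      = (\<Sum>k\<in>UNIV. transit T i k (word_monom u) * transit T k m (word_monom v))"
    proof (induction u arbitrary: i)
      case Nil
      then show ?case
        by (simp add: word_monom_Nil if_distrib[of "\<lambda>t. t * _"] cong: if_cong)
    next
      case (Cons j u)
      let ?t = "\<lambda>k p. transit_word T u k p * transit_word T v p m"
      have "transit T i m (word_monom (j # u) * word_monom v)
        = (\<Sum>k\<in>UNIV. \<Sum>l\<in>UNIV. \<Sum>p\<in>UNIV. cscale (T i j k l) (word_monom [l] * ?t k p))"
        using Cons by (simp add: word_monom_mult sum_distrib_left cvec.scale_sum_right)
      also have "\<dots> = (\<Sum>p\<in>UNIV. \<Sum>k\<in>UNIV. \<Sum>l\<in>UNIV. cscale (T i j k l) (word_monom [l] * ?t k p))"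
        by (rule sum_rotate)
      finally show ?case
        by (simp add: sum_distrib_right mult.assoc)
    qed
  qed (intro clinear_intros)+
qed (intro clinear_intros)+

text \<open>A twisted Leibniz rule: the adjoint is either absorbed in \<open>x\<close>, or passes
  \<open>x\<close> with a new index \<open>k\<close> and is absorbed in \<open>y\<close>.\<close>

lemma annih_mult:
  "annih T i (x * y) = annih T i x * y + (\<Sum>k\<in>UNIV. transit T i k x * annih T k y)"
proof (rule clinear_eq[where x = x and f = "\<lambda>x. annih T i (x * y)"])
  fix u
  show "annih T i (word_monom u * y) =
    annih T i (word_monom u) * y + (\<Sum>k\<in>UNIV. transit T i k (word_monom u) * annih T k y)"
  proof (induction u arbitrary: i)
    case Nil
    then show ?case
      by (simp add: word_monom_Nil if_distrib[of "\<lambda>t. t * _"] cong: if_cong)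
  next
    case (Cons j u)
    let ?t = "\<lambda>k p. transit_word T u k p * annih T p y"
    have *: "word_monom (j # u) * y = word_monom [j] * (word_monom u * y)"
      by (simp add: mult.assoc[symmetric] word_monom_mult)
    have "annih T i (word_monom (j # u) * y) = (if i = j then word_monom u * y else 0) +
       (\<Sum>k\<in>UNIV. \<Sum>l\<in>UNIV. cscale (T i j k l) (word_monom [l] * (annih_word T u k * y))) +
       (\<Sum>k\<in>UNIV. \<Sum>l\<in>UNIV. \<Sum>p\<in>UNIV. cscale (T i j k l) (word_monom [l] * ?t k p))"
      unfolding * annih_gen_mult using Cons
      by (simp add: sum_distrib_left cvec.scale_sum_right distrib_left cvec.scale_right_distrib sum.distrib)
    also have "(\<Sum>k\<in>UNIV. \<Sum>l\<in>UNIV. \<Sum>p\<in>UNIV. cscale (T i j k l) (word_monom [l] * ?t k p))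
      = (\<Sum>p\<in>UNIV. \<Sum>k\<in>UNIV. \<Sum>l\<in>UNIV. cscale (T i j k l) (word_monom [l] * ?t k p))"
      by (rule sum_rotate)
    finally show ?case
      by (simp add: sum_distrib_right mult.assoc distrib_right)
  qed
qed (intro clinear_intros)+

section \<open>Identification of \<open>annih\<close> and \<open>transit\<close> with R_n and T_1
  ... T_n\<close>

lemma T_at_gen_gen_mult:
  "T_at T 1 (word_monom [j] * (word_monom [k] * x)) = T_basis T j k * x"
  by (rule clinear_eq[where x = x])
     (auto simp: T_at_word word_monom_mult word_monom_Nil intro!: clinear_intros)

text \<open>The coefficients with which an adjoint passes the letter \<open>j\<close> are the matrix
  entries of T on e_j \<otimes> e_k. Hence the double sum in the recursions of
  \<open>annih_word\<close> and \<open>transit_word\<close> is an application of T_1.\<close>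

lemma T_at_gen_mult_sum:
  "T_at T 1 (word_monom [j] * (\<Sum>k\<in>UNIV. word_monom [k] * f k))
     = (\<Sum>i\<in>UNIV. word_monom [i] * (\<Sum>k\<in>UNIV. \<Sum>l\<in>UNIV. cscale (T i j k l) (word_monom [l] * f k)))"
proof -
  have "clinear (T_at T 1)" by (intro clinear_intros)
  then have "T_at T 1 (word_monom [j] * (\<Sum>k\<in>UNIV. word_monom [k] * f k))
    = (\<Sum>k\<in>UNIV. T_basis T j k * f k)"
    by (simp only: sum_distrib_left cpair.linear_sum T_at_gen_gen_mult)
  also have "\<dots> = (\<Sum>k\<in>UNIV. \<Sum>i\<in>UNIV. \<Sum>l\<in>UNIV. cscale (T i j k l) (word_monom [i, l] * f k))"
    by (simp add: T_basis_def sum_distrib_right)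
  also have "\<dots> = (\<Sum>i\<in>UNIV. \<Sum>k\<in>UNIV. \<Sum>l\<in>UNIV. cscale (T i j k l) (word_monom [i, l] * f k))"
    by (rule sum.swap)
  finally show ?thesis
    by (simp add: sum_distrib_left mult.assoc[symmetric] word_monom_mult)
qed

text \<open>R_(n+1) = 1 + T_1 (1 \<otimes> R_n) matches the recursion of \<open>annih_word\<close>
  term by term: the identity gives the Kronecker delta, T_1 the double sum.\<close>

lemma R_op_eq_annih:
  "x \<in> tpow n \<Longrightarrow> R_op T n x = (\<Sum>i\<in>UNIV. word_monom [i] * annih T i x)"
proof (rule clinear_eq_on_tpow[where f = "R_op T n"])
  show "R_op T n (word_monom w) = (\<Sum>i\<in>UNIV. word_monom [i] * annih T i (word_monom w))"
    if "length w = n" for w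
    using that
  proof (induction w arbitrary: n)
    case Nil
    then show ?case by (simp add: R_op_def)
  next
    case (Cons j w)
    define n' where "n' = length w"
    have n: "n = Suc n'" using Cons.prems by (simp add: n'_def)
    have split: "word_monom (j # w) = word_monom [j] * word_monom w"
      by (simp add: word_monom_mult)
    have "(\<Sum>k<n'. T_prod_tail T k (word_monom (j # w))) = word_monom [j] * R_op T n' (word_monom w)"
      by (simp add: split T_prod_tail_mult_left word_monom_tpow R_op_def sum_distrib_left)
    then have R: "R_op T n (word_monom (j # w)) = word_monom (j # w) +
        T_at T 1 (word_monom [j] * (\<Sum>k\<in>UNIV. word_monom [k] * annih_word T w k))"
      using Cons.IH[of n'] by (simp only: n R_op_Suc_tail) (simp add: n'_def)
    have first: "(\<Sum>i\<in>UNIV. word_monom [i] * (if i = j then word_monom w else 0)) = word_monom (j # w)"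
      by (simp add: split if_distrib[of "\<lambda>t. _ * t"] cong: if_cong)
    show ?case
      by (simp only: R T_at_gen_mult_sum annih_word_monom annih_word.simps distrib_left sum.distrib first)
  qed
qed (auto intro!: clinear_intros)

text \<open>Induction on the word with T_1 ... T_(n+1) = T_1 (1 \<otimes> T_1 ... T_n), which is the
  recursion of \<open>transit_word\<close>.\<close>

lemma T_prod_eq_transit:
  "x \<in> tpow n \<Longrightarrow> T_prod T n (x * word_monom [m]) = (\<Sum>i\<in>UNIV. word_monom [i] * transit T i m x)"
proof (rule clinear_eq_on_tpow[where f = "\<lambda>x. T_prod T n (x * word_monom [m])"])
  show "T_prod T n (word_monom w * word_monom [m])
      = (\<Sum>i\<in>UNIV. word_monom [i] * transit T i m (word_monom w))" if "length w = n" for w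
    using that
  proof (induction w arbitrary: n)
    case Nil
    then show ?case
      by (simp add: word_monom_Nil if_distrib[of "\<lambda>t. _ * t"] flip: transit_word_monom cong: if_cong)
  next
    case (Cons j w)
    define n' where "n' = length w"
    have n: "n = Suc n'" using Cons.prems by (simp add: n'_def)
    have split: "word_monom (j # w) * word_monom [m] = word_monom [j] * (word_monom w * word_monom [m])"
      by (simp add: word_monom_mult)
    show ?case
      using Cons.IH[of n']
      by (simp only: n T_prod_Suc_tail split T_prod_tail_mult_left word_monom_tpow length_Cons list.size)
         (simp add: T_prod_tail_mult_left word_monom_tpow n'_def T_at_gen_mult_sum[simplified])
  qed
qed (auto intro!: clinear_intros)

lemma R_op_eq_0_iff_annih:
  assumes "x \<in> tpow n"
  shows "R_op T n x = 0 \<longleftrightarrow> (\<forall>i. annih T i x = 0)"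
  using sum_gen_mult_eq_0[of "\<lambda>i. annih T i x"] by (auto simp: R_op_eq_annih[OF assms])

text \<open>Apply (1 \<otimes> R_n) U = U (R_n \<otimes> 1) with U = T_1 ... T_n to x \<otimes> e_m.
  The right side vanishes, and the components of the left side along the first factor are the values
  of R_n on the transits.\<close>

lemma R_op_transit:
  assumes T: "braided T" and x: "x \<in> tpow n" "R_op T n x = 0"
  shows "R_op T n (transit T i m x) = 0"
proof (rule sum_gen_mult_eq_0[where f = "\<lambda>i. R_op T n (transit T i m x)"])
  have xm: "x * word_monom [m] \<in> tpow (Suc n)"
    using tpow_mult[OF x(1) word_monom_tpow[of "[m]" 1]] by simp
  have "(\<Sum>i\<in>UNIV. word_monom [i] * R_op T n (transit T i m x))
      = (\<Sum>k<n. \<Sum>i\<in>UNIV. word_monom [i] * T_prod T k (transit T i m x))"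
    by (simp add: R_op_def sum_distrib_left) (rule sum.swap)
  also have "\<dots> = (\<Sum>k<n. T_prod_tail T k (\<Sum>i\<in>UNIV. word_monom [i] * transit T i m x))"
  proof (rule sum.cong[OF refl])
    fix k
    have "T_prod_tail T k (u + v) = T_prod_tail T k u + T_prod_tail T k v"
       "T_prod_tail T k (cscale c u) = cscale c (T_prod_tail T k u)" for u v c
      by (induction k arbitrary: u v)
         (simp_all add: cpair.linear_add[OF clinear_T_at[OF clinear_ident]] cpair.linear_scale[OF clinear_T_at[OF clinear_ident]])
    then have "clinear (T_prod_tail T k)" by (rule clinearI)
    then show "(\<Sum>i\<in>UNIV. word_monom [i] * T_prod T k (transit T i m x))
      = T_prod_tail T k (\<Sum>i\<in>UNIV. word_monom [i] * transit T i m x)"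
      by (simp add: cpair.linear_sum T_prod_tail_mult_left word_monom_tpow)
  qed
  also have "\<dots> = T_prod T n (R_op T n (x * word_monom [m]))"
    using T_prod_R_op[OF T lessI xm] by (simp add: T_prod_eq_transit[OF x(1)])
  also have "\<dots> = 0"
    using cpair.linear_0[OF clinear_T_prod[OF clinear_ident]] by (simp add: R_op_mult_right x)
  finally show "(\<Sum>i\<in>UNIV. word_monom [i] * R_op T n (transit T i m x)) = 0" .
qed

section \<open>Two-sided ideals of the tensor algebra, before passing to the Wick algebra\<close>

definition ideal_span :: "'a free_alg set \<Rightarrow> 'a free_alg set" where
  "ideal_span I0 = cvec.span {u * x * v | u x v. x \<in> I0}"

lemma ideal_span_base: "x \<in> I0 \<Longrightarrow> x \<in> ideal_span I0"
  unfolding ideal_span_def by (rule cvec.span_base) (metis (mono_tags, lifting) mem_Collect_eq mult_1 mult_1_right)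

lemma ideal_span_induct [consumes 1, case_names linear subspace gen]:
  assumes "y \<in> ideal_span I0" "clinear f" "cvec.subspace S"
    and "\<And>u x v. x \<in> I0 \<Longrightarrow> f (u * x * v) \<in> S"
  shows "f y \<in> S"
proof -
  have "cvec.subspace (f -` S)"
    using cpair.linear_subspace_vimage[OF assms(2,3)] .
  then have "ideal_span I0 \<subseteq> f -` S"
    unfolding ideal_span_def by (intro cvec.span_minimal) (use assms(4) in auto)
  with assms(1) show ?thesis by auto
qed

lemma subspace_ideal_span: "cvec.subspace (ideal_span I0)"
  unfolding ideal_span_def by (rule cvec.subspace_span)

lemmas ideal_span_closed =
  cvec.subspace_0[OF subspace_ideal_span] cvec.subspace_add[OF subspace_ideal_span]
  cvec.subspace_sum[OF subspace_ideal_span] cvec.subspace_scale[OF subspace_ideal_span]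
  cvec.subspace_neg[OF subspace_ideal_span]

lemma ideal_span_gen: "x \<in> I0 \<Longrightarrow> u * x * v \<in> ideal_span I0"
  unfolding ideal_span_def by (rule cvec.span_base) blast

lemma ideal_span_mult_left: "y \<in> ideal_span I0 \<Longrightarrow> z * y \<in> ideal_span I0"
  by (erule ideal_span_induct[where f = "\<lambda>y. z * y"], intro clinear_intros, rule subspace_ideal_span)
     (metis ideal_span_gen mult.assoc)

lemma ideal_span_mult_right: "y \<in> ideal_span I0 \<Longrightarrow> y * z \<in> ideal_span I0"
  by (erule ideal_span_induct[where f = "\<lambda>y. y * z"], intro clinear_intros, rule subspace_ideal_span)
     (metis ideal_span_gen mult.assoc)

lemma ideal_span_mono: "I0 \<subseteq> J0 \<Longrightarrow> ideal_span I0 \<subseteq> ideal_span J0"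
  unfolding ideal_span_def by (rule cvec.span_mono) blast

text \<open>By the product rules, every term of the image of \<open>u * x * v\<close> keeps a factor
  from \<open>I0\<close>, namely \<open>x\<close> or a transit of \<open>x\<close>, except those
  containing \<open>annih\<close> of \<open>x\<close>, which vanish.\<close>

lemma ideal_span_annih:
  assumes annih: "\<And>x i. x \<in> I0 \<Longrightarrow> annih T i x = 0"
    and transit: "\<And>x i m. x \<in> I0 \<Longrightarrow> transit T i m x \<in> I0"
    and y: "y \<in> ideal_span I0"
  shows "annih T i y \<in> ideal_span I0" "transit T i m y \<in> ideal_span I0"
proof -
  show "annih T i y \<in> ideal_span I0"
    using y
  proof (induction rule: ideal_span_induct[where f = "annih T i"])
    case (gen u x v)
    then show ?case
      by (simp add: annih_mult transit_mult annih sum_distrib_right)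
         (intro ideal_span_closed ideal_span_gen transit)
  qed (intro clinear_intros subspace_ideal_span)+
  show "transit T i m y \<in> ideal_span I0"
    using y
  proof (induction rule: ideal_span_induct[where f = "transit T i m"])
    case (gen u x v)
    then show ?case
      by (simp add: transit_mult sum_distrib_right)
         (intro ideal_span_closed ideal_span_gen transit)
  qed (intro clinear_intros subspace_ideal_span)+
qed


section \<open>Subspaces of the Wick algebra\<close>

text \<open>The lift of \<open>to_wick\<close> to representatives. Subspaces and ideals of the Wick
  algebra are handled below as images of subspaces of the free algebra.\<close>

definition gen_embed :: "'d free_alg \<Rightarrow> 'd letter free_alg" where
  "gen_embed = lin_ext (\<lambda>w. word_monom (map Gen w))"

definition adj_embed :: "'d free_alg \<Rightarrow> 'd letter free_alg" where
  "adj_embed = lin_ext (\<lambda>w. word_monom (map Adj w))"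

lemma clinear_gen_embed [clinear_intros]: "clinear f \<Longrightarrow> clinear (\<lambda>x. gen_embed (f x))"
  unfolding gen_embed_def by (rule clinear_lin_ext)

lemma clinear_adj_embed [clinear_intros]: "clinear f \<Longrightarrow> clinear (\<lambda>x. adj_embed (f x))"
  unfolding adj_embed_def by (rule clinear_lin_ext)

lemma gen_embed_word_monom [simp]: "gen_embed (word_monom w) = word_monom (map Gen w)"
  by (simp add: gen_embed_def)

lemma adj_embed_word_monom [simp]: "adj_embed (word_monom w) = word_monom (map Adj w)"
  by (simp add: adj_embed_def)

lemma gen_embed_mult: "gen_embed (x * y) = gen_embed x * gen_embed y"
proof (rule clinear_eq[where x = x and f = "\<lambda>x. gen_embed (x * y)"])
  show "gen_embed (word_monom u * y) = gen_embed (word_monom u) * gen_embed y" for u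
    by (rule clinear_eq[where x = y and f = "\<lambda>y. gen_embed (word_monom u * y)"])
       (simp add: word_monom_mult | intro clinear_intros)+
qed (intro clinear_intros)+

lemma adj_embed_mult: "adj_embed (x * y) = adj_embed x * adj_embed y"
proof (rule clinear_eq[where x = x and f = "\<lambda>x. adj_embed (x * y)"])
  show "adj_embed (word_monom u * y) = adj_embed (word_monom u) * adj_embed y" for u
    by (rule clinear_eq[where x = y and f = "\<lambda>y. adj_embed (word_monom u * y)"])
       (simp add: word_monom_mult | intro clinear_intros)+
qed (intro clinear_intros)+

lemma to_wick_conv: "to_wick T x = wick_class T (gen_embed x)"
  by (simp add: to_wick_def gen_embed_def)

lemma wick_algebra_inverse: "\<ominus>\<^bsub>wick_algebra T\<^esub> wick_class T x = wick_class T (- x)"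
proof -
  interpret ring "wick_algebra T" by (rule ring_wick_algebra)
  have "wick_class T (- x) \<oplus>\<^bsub>wick_algebra T\<^esub> wick_class T x = \<zero>\<^bsub>wick_algebra T\<^esub>"
    by (simp add: wick_algebra_simps)
  then show ?thesis
    by (rule minus_equality) (simp_all add: carrier_wick_algebra)
qed

lemma submodule_wick_image:
  assumes "cvec.subspace S"
  shows "submodule (wick_class T ` S) complex_ring (wick_algebra T)"
proof (rule module.submoduleI[OF module_wick_algebra])
  show "wick_class T ` S \<subseteq> carrier (wick_algebra T)"
    by (auto simp: carrier_wick_algebra)
  show "\<zero>\<^bsub>wick_algebra T\<^esub> \<in> wick_class T ` S"
    using cvec.subspace_0[OF assms] by (auto simp: wick_algebra_simps)
  show "\<ominus>\<^bsub>wick_algebra T\<^esub> a \<in> wick_class T ` S" if "a \<in> wick_class T ` S" for a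
    using that cvec.subspace_neg[OF assms] by (auto simp: wick_algebra_inverse)
  show "a \<oplus>\<^bsub>wick_algebra T\<^esub> b \<in> wick_class T ` S"
    if "a \<in> wick_class T ` S" "b \<in> wick_class T ` S" for a b
    using that cvec.subspace_add[OF assms] by (auto simp: wick_algebra_simps)
  show "c \<odot>\<^bsub>wick_algebra T\<^esub> a \<in> wick_class T ` S" if "a \<in> wick_class T ` S" for c a
    using that cvec.subspace_scale[OF assms] by (auto simp: wick_algebra_simps)
qed

lemma submodule_wick_vimage:
  assumes "submodule U complex_ring (wick_algebra T)"
  shows "cvec.subspace {x. wick_class T x \<in> U}"
proof (rule cvec.subspaceI)
  note U = module.submoduleE[OF module_wick_algebra assms]
  \<comment> \<open>Membership of zero will follow by scaling some element of the nonempty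
    \<open>U\<close> by 0.\<close>
  obtain a where a: "a \<in> U" using U(2) by blast
  then obtain x where x: "a = wick_class T x"
    using U(1) by (auto simp: carrier_wick_algebra)
  have scale: "wick_class T (cscale c x) \<in> U" if "wick_class T x \<in> U" for c x
    using U(4)[OF _ that, of c] by (simp add: wick_algebra_simps ring_of_type_algebra_def)
  show "0 \<in> {x. wick_class T x \<in> U}"
    using scale[of x 0] a x by simp
  show "x + y \<in> {x. wick_class T x \<in> U}"
    if "x \<in> {x. wick_class T x \<in> U}" "y \<in> {x. wick_class T x \<in> U}" for x y
    using U(5)[of "wick_class T x" "wick_class T y"] that by (simp add: wick_algebra_simps)
  show "cscale c x \<in> {x. wick_class T x \<in> U}" if "x \<in> {x. wick_class T x \<in> U}" for c x
    using scale that by simp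
qed

text \<open>Images of subspaces under \<open>wick_class T\<close> are submodules and preimages of
  submodules are subspaces, so taking classes commutes with taking spans.\<close>

lemma wick_span_eq: "wick_span T (wick_class T ` S) = wick_class T ` cvec.span S"
proof
  show "wick_span T (wick_class T ` S) \<subseteq> wick_class T ` cvec.span S"
    unfolding wick_span_def
    using submodule_wick_image[OF cvec.subspace_span, of T S] cvec.span_superset[of S] by blast
  have "cvec.span S \<subseteq> {x. wick_class T x \<in> U}"
    if "submodule U complex_ring (wick_algebra T)" "wick_class T ` S \<subseteq> U" for U
    using that(2) by (intro cvec.span_minimal submodule_wick_vimage that(1)) auto
  then show "wick_class T ` cvec.span S \<subseteq> wick_span T (wick_class T ` S)"
    unfolding wick_span_def by blast
qed

lemma wick_tensor_eq:
  "wick_tensor T (wick_class T ` A) (wick_class T ` B)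
     = wick_class T ` cvec.span {x * y | x y. x \<in> A \<and> y \<in> B}"
proof -
  have "{x \<otimes>\<^bsub>wick_algebra T\<^esub> y | x y. x \<in> wick_class T ` A \<and> y \<in> wick_class T ` B}
      = wick_class T ` {x * y | x y. x \<in> A \<and> y \<in> B}"
    by (auto simp: wick_algebra_simps image_iff) (metis wick_algebra_simps(3))+
  then show ?thesis by (simp add: wick_tensor_def wick_span_eq)
qed

text \<open>Stated for an arbitrary unital algebra homomorphism \<open>E\<close> so that it computes
  both \<open>TH\<close> and \<open>TH_dual\<close>. The range of \<open>E\<close> is itself a
  subalgebra, and every subalgebra with the generators contains the images of all words.\<close>

lemma wick_subalgebra_eq:
  fixes E :: "'d free_alg \<Rightarrow> ('e::finite) letter free_alg"
  assumes lin: "clinear E" and mult: "\<And>x y. E (x * y) = E x * E y" and one: "E 1 = 1"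
  shows "wick_subalgebra T (range (\<lambda>i. wick_class T (E (word_monom [i])))) = range (\<lambda>x. wick_class T (E x))"
    (is "wick_subalgebra T ?G = ?R")
proof
  have R: "?R = wick_class T ` range E" by blast
  have "submodule ?R complex_ring (wick_algebra T)"
    unfolding R using cpair.linear_subspace_image[OF lin cvec.subspace_UNIV]
    by (rule submodule_wick_image)
  moreover have "subring ?R (wick_algebra T)"
  proof (rule ring.subringI[OF ring_wick_algebra])
    show "\<one>\<^bsub>wick_algebra T\<^esub> \<in> ?R"
      by (auto simp: wick_algebra_simps intro!: range_eqI[of _ _ 1] simp: one)
    show "\<ominus>\<^bsub>wick_algebra T\<^esub> a \<in> ?R" if "a \<in> ?R" for a
      using that by (auto simp: wick_algebra_inverse simp flip: cpair.linear_neg[OF lin])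
  qed (auto simp: carrier_wick_algebra wick_algebra_simps simp flip: mult cpair.linear_add[OF lin])
  ultimately show "wick_subalgebra T ?G \<subseteq> ?R"
    unfolding wick_subalgebra_def by blast
  have "wick_class T (E x) \<in> A"
    if A: "subring A (wick_algebra T)" "submodule A complex_ring (wick_algebra T)" "?G \<subseteq> A" for A x
  proof -
    note s = subringE[OF A(1)]
    have "wick_class T (E (word_monom w)) \<in> A" for w
    proof (induction w)
      case Nil
      then show ?case using s(3) by (simp add: word_monom_Nil one wick_algebra_simps)
    next
      case (Cons i w)
      have "word_monom (i # w) = word_monom [i] * word_monom w"
        by (simp add: word_monom_mult)
      then have "wick_class T (E (word_monom (i # w)))
          = wick_class T (E (word_monom [i])) \<otimes>\<^bsub>wick_algebra T\<^esub> wick_class T (E (word_monom w))"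
        by (simp add: mult wick_algebra_simps)
      moreover have "wick_class T (E (word_monom [i])) \<in> A" using A(3) by blast
      ultimately show ?case using s(6) Cons by simp
    qed
    moreover have "cvec.subspace (E -` {y. wick_class T y \<in> A})"
      by (intro cpair.linear_subspace_vimage lin submodule_wick_vimage A(2))
    ultimately have "cvec.span (range word_monom) \<subseteq> E -` {y. wick_class T y \<in> A}"
      by (intro cvec.span_minimal) auto
    then show ?thesis by (auto simp: span_words)
  qed
  then show "?R \<subseteq> wick_subalgebra T ?G"
    unfolding wick_subalgebra_def by blast
qed

lemma gen_embed_1 [simp]: "gen_embed 1 = 1"
  using gen_embed_word_monom[of "[]"] by (simp add: word_monom_Nil)

lemma adj_embed_1 [simp]: "adj_embed 1 = 1"
  using adj_embed_word_monom[of "[]"] by (simp add: word_monom_Nil)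

lemma TH_eq: "TH T = wick_class T ` range gen_embed"
  using wick_subalgebra_eq[OF clinear_gen_embed[OF clinear_ident] gen_embed_mult, of T]
  by (simp add: TH_def image_image)

lemma TH_dual_eq: "TH_dual T = wick_class T ` range adj_embed"
  using wick_subalgebra_eq[OF clinear_adj_embed[OF clinear_ident] adj_embed_mult, of T]
  by (simp add: TH_dual_def image_image)

lemma subring_TH: "subring (TH T) (wick_algebra T)"
proof (rule ring.subringI[OF ring_wick_algebra])
  note lin = clinear_gen_embed[OF clinear_ident]
  show "\<one>\<^bsub>wick_algebra T\<^esub> \<in> TH T"
    by (auto simp: TH_eq wick_algebra_simps image_image intro!: range_eqI[of _ _ 1])
  show "\<ominus>\<^bsub>wick_algebra T\<^esub> a \<in> TH T" if "a \<in> TH T" for a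
    using that by (auto simp: TH_eq wick_algebra_inverse simp flip: cpair.linear_neg[OF lin])
qed (auto simp: TH_eq carrier_wick_algebra wick_algebra_simps
       simp flip: gen_embed_mult cpair.linear_add[OF clinear_gen_embed[OF clinear_ident]])

lemma ring_TH_ring: "ring (TH_ring T)"
  by (rule ring.subring_is_ring[OF ring_wick_algebra subring_TH])

lemma generated_ideal_eq: "generated_ideal T I0 = to_wick T ` ideal_span I0"
proof
  interpret R: ring "TH_ring T" by (rule ring_TH_ring)
  note lin = clinear_gen_embed[OF clinear_ident]
  have carr: "carrier (TH_ring T) = range (to_wick T)"
    by (auto simp: TH_eq to_wick_conv)
  have add: "to_wick T x \<oplus>\<^bsub>TH_ring T\<^esub> to_wick T y = to_wick T (x + y)" for x y
    by (simp add: to_wick_conv wick_algebra_simps cpair.linear_add[OF lin])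
  have mult: "to_wick T x \<otimes>\<^bsub>TH_ring T\<^esub> to_wick T y = to_wick T (x * y)" for x y
    by (simp add: to_wick_conv wick_algebra_simps gen_embed_mult)
  have zero: "\<zero>\<^bsub>TH_ring T\<^esub> = to_wick T 0"
    by (simp add: to_wick_conv wick_algebra_simps cpair.linear_0[OF lin])
  have neg: "\<ominus>\<^bsub>TH_ring T\<^esub> to_wick T x = to_wick T (- x)" for x
    by (rule R.minus_equality) (simp_all only: add carr zero rangeI, simp)
  have "ideal (to_wick T ` ideal_span I0) (TH_ring T)"
  proof (rule idealI[OF ring_TH_ring])
    show "subgroup (to_wick T ` ideal_span I0) (add_monoid (TH_ring T))"
    proof (rule R.add.subgroupI)
      show "to_wick T ` ideal_span I0 \<subseteq> carrier (TH_ring T)" by (auto simp only: carr)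
      show "to_wick T ` ideal_span I0 \<noteq> {}" using ideal_span_closed(1) by blast
      show "\<ominus>\<^bsub>TH_ring T\<^esub> a \<in> to_wick T ` ideal_span I0" if "a \<in> to_wick T ` ideal_span I0" for a
        using that by (auto simp only: neg intro!: imageI ideal_span_closed)
      show "a \<oplus>\<^bsub>TH_ring T\<^esub> b \<in> to_wick T ` ideal_span I0"
        if "a \<in> to_wick T ` ideal_span I0" "b \<in> to_wick T ` ideal_span I0" for a b
        using that by (auto simp only: add intro!: imageI ideal_span_closed)
    qed
    fix a x assume "a \<in> to_wick T ` ideal_span I0" "x \<in> carrier (TH_ring T)"
    then show "x \<otimes>\<^bsub>TH_ring T\<^esub> a \<in> to_wick T ` ideal_span I0" "a \<otimes>\<^bsub>TH_ring T\<^esub> x \<in> to_wick T ` ideal_span I0"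
      unfolding carr
      by (auto simp only: mult intro!: imageI intro: ideal_span_mult_left ideal_span_mult_right)
  qed
  then show "generated_ideal T I0 \<subseteq> to_wick T ` ideal_span I0"
    unfolding generated_ideal_def by (rule R.genideal_minimal) (auto intro: ideal_span_base)
  have "to_wick T ` I0 \<subseteq> carrier (TH_ring T)" by (auto simp only: carr)
  note gen = R.genideal_ideal[OF this] R.genideal_self[OF this]
  interpret I: ideal "genideal (TH_ring T) (to_wick T ` I0)" "TH_ring T" by (rule gen(1))
  have "ideal_span I0 \<subseteq> {x. to_wick T x \<in> genideal (TH_ring T) (to_wick T ` I0)}" (is "_ \<subseteq> ?V")
    unfolding ideal_span_def
  proof (rule cvec.span_minimal)
    have r: "to_wick T x \<in> carrier (TH_ring T)" for x by (auto simp only: carr)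
    show "{u * x * v |u x v. x \<in> I0} \<subseteq> ?V"
      using gen(2) I.I_l_closed[OF _ r] I.I_r_closed[OF _ r] by (auto simp only: mult[symmetric])
    show "cvec.subspace ?V"
    proof (rule cvec.subspaceI)
      show "0 \<in> ?V" using I.zero_closed zero by simp
      show "x + y \<in> ?V" if "x \<in> ?V" "y \<in> ?V" for x y
        using I.a_closed that by (simp only: add[symmetric] mem_Collect_eq)
      show "cscale c x \<in> ?V" if "x \<in> ?V" for c x
      proof -
        \<comment> \<open>\<open>genideal\<close> yields an ideal of rings, with no scalars in its
          definition; scaling is recovered as multiplication by a multiple of the unit.\<close>
        have "to_wick T (cscale c x) = to_wick T (cscale c 1) \<otimes>\<^bsub>TH_ring T\<^esub> to_wick T x"
          unfolding mult by simp
        then show ?thesis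
          using I.I_l_closed[OF _ r] that by (simp only: mem_Collect_eq)
      qed
    qed
  qed
  then show "to_wick T ` ideal_span I0 \<subseteq> generated_ideal T I0"
    by (auto simp: generated_ideal_def)
qed

section \<open>Normal ordering in the Wick algebra and the Wick property\<close>

lemma wick_class_cong_add:
  "wick_class T x = wick_class T x' \<Longrightarrow> wick_class T y = wick_class T y' \<Longrightarrow>
   wick_class T (x + y) = wick_class T (x' + y')"
  by (metis wick_algebra_simps(4))

lemma wick_class_cong_mult:
  "wick_class T x = wick_class T x' \<Longrightarrow> wick_class T y = wick_class T y' \<Longrightarrow>
   wick_class T (x * y) = wick_class T (x' * y')"
  by (metis wick_algebra_simps(3))

lemma wick_class_cong_cscale:
  "wick_class T x = wick_class T y \<Longrightarrow> wick_class T (cscale c x) = wick_class T (cscale c y)"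
  by (metis wick_algebra_simps(5))

lemma wick_class_cong_sum:
  assumes "\<And>i. i \<in> A \<Longrightarrow> wick_class T (f i) = wick_class T (g i)"
  shows "wick_class T (sum f A) = wick_class T (sum g A)"
  using assms
proof (induction A rule: infinite_finite_induct)
  case (insert a A)
  then show ?case
    unfolding sum.insert[OF insert.hyps] by (intro wick_class_cong_add) blast+
qed simp_all

text \<open>The Wick relation moves the adjoint past the first letter, and the induction hypothesis
  moves the resulting adjoints past the rest of the word.\<close>

lemma wick_class_adj_gen_mult:
  "wick_class T (word_monom [Adj i] * gen_embed x) =
   wick_class T (gen_embed (annih T i x) + (\<Sum>m\<in>UNIV. gen_embed (transit T i m x) * word_monom [Adj m]))"
  (is "wick_class T (?L i x) = wick_class T (?R i x)")
proof (induction x rule: free_alg_induct)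
  case (single w c)
  have words: "wick_class T (?L i (word_monom w)) = wick_class T (?R i (word_monom w))"
  proof (induction w arbitrary: i)
    case Nil
    then show ?case
      by (simp add: word_monom_Nil if_distrib[of gen_embed] if_distrib[of "\<lambda>t. t * _"]
            cpair.linear_0[OF clinear_gen_embed[OF clinear_ident]] cong: if_cong)
  next
    case (Cons j w)
    note lin = clinear_gen_embed[OF clinear_ident]
    let ?w = "word_monom (map Gen w) :: 'a letter free_alg"
    have rel: "wick_class T (word_monom [Adj i] * word_monom [Gen j]) = wick_class T ((if i = j then 1 else 0) +
        (\<Sum>k\<in>UNIV. \<Sum>l\<in>UNIV. cscale (T i j k l) (word_monom [Gen l] * word_monom [Adj k])))"
      using wick_relation[of T i j] by (simp only: wick_algebra_simps)
    have "?L i (word_monom (j # w)) = (word_monom [Adj i] * word_monom [Gen j]) * ?w"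
      by (simp add: word_monom_mult)
    also have "wick_class T \<dots> = wick_class T (((if i = j then 1 else 0) +
        (\<Sum>k\<in>UNIV. \<Sum>l\<in>UNIV. cscale (T i j k l) (word_monom [Gen l] * word_monom [Adj k]))) * ?w)"
      by (rule wick_class_cong_mult[OF rel refl])
    also have "\<dots> = wick_class T ((if i = j then ?w else 0) +
        (\<Sum>k\<in>UNIV. \<Sum>l\<in>UNIV. cscale (T i j k l) (word_monom [Gen l] * ?L k (word_monom w))))"
      by (simp add: distrib_right sum_distrib_right mult.assoc)
    also have "\<dots> = wick_class T ((if i = j then ?w else 0) +
        (\<Sum>k\<in>UNIV. \<Sum>l\<in>UNIV. cscale (T i j k l) (word_monom [Gen l] * ?R k (word_monom w))))"
      by (intro wick_class_cong_add wick_class_cong_sum wick_class_cong_cscale wick_class_cong_mult refl Cons.IH)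
    also have "(if i = j then ?w else 0) +
        (\<Sum>k\<in>UNIV. \<Sum>l\<in>UNIV. cscale (T i j k l) (word_monom [Gen l] * ?R k (word_monom w)))
        = ?R i (word_monom (j # w))"
    proof -
      \<comment> \<open>Regrouping by the index \<open>m\<close> of the adjoint that finally emerges
        on the right produces the recursion of \<open>transit_word\<close>.\<close>
      have "(\<Sum>k\<in>UNIV. \<Sum>l\<in>UNIV. \<Sum>m\<in>UNIV. cscale (T i j k l)
              (word_monom [Gen l] * (gen_embed (transit_word T w k m) * word_monom [Adj m])))
          = (\<Sum>m\<in>UNIV. gen_embed (transit_word T (j # w) i m) * word_monom [Adj m])"
        by (subst sum_rotate, simp add: cpair.linear_sum[OF lin] cpair.linear_scale[OF lin] gen_embed_mult sum_distrib_right mult.assoc)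
      moreover have "(if i = j then ?w else 0) + (\<Sum>k\<in>UNIV. \<Sum>l\<in>UNIV. cscale (T i j k l)
              (word_monom [Gen l] * gen_embed (annih_word T w k))) = gen_embed (annih_word T (j # w) i)"
        by (simp add: cpair.linear_sum[OF lin] cpair.linear_add[OF lin] cpair.linear_scale[OF lin] cpair.linear_0[OF lin] gen_embed_mult)
      ultimately show ?thesis
        by (simp only: annih_word_monom transit_word_monom distrib_left sum_distrib_left cvec.scale_right_distrib
              cvec.scale_sum_right sum.distrib) (simp add: add.assoc[symmetric])
    qed
    finally show ?case .
  qed
  have s: "Poly_Mapping.single w c = cscale c (word_monom w)"
    by (simp add: word_monom_def cscale_def)
  have L: "clinear (?L i)" and R: "clinear (?R i)" by (intro clinear_intros)+
  show ?case
    unfolding s cpair.linear_scale[OF L] cpair.linear_scale[OF R]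
    by (rule wick_class_cong_cscale[OF words])
next
  case (add x y)
  have L: "clinear (?L i)" and R: "clinear (?R i)" by (intro clinear_intros)+
  show ?case
    unfolding cpair.linear_add[OF L] cpair.linear_add[OF R] by (rule wick_class_cong_add[OF add])
qed

lemma generated_ideal_is_ideal: "ideal (generated_ideal T I0) (TH_ring T)"
  unfolding generated_ideal_def
  by (rule ring.genideal_ideal[OF ring_TH_ring]) (auto simp: TH_eq to_wick_conv)

lemma wick_ideal_generated_ideal:
  assumes annih: "\<And>x i. x \<in> I0 \<Longrightarrow> annih T i x = 0"
    and transit: "\<And>x i m. x \<in> I0 \<Longrightarrow> transit T i m x \<in> I0"
  shows "wick_ideal T (generated_ideal T I0)"
proof -
  let ?J = "ideal_span I0"
  define S where "S = cvec.span {x * y | x y. x \<in> gen_embed ` ?J \<and> y \<in> range adj_embed}"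
  \<comment> \<open>\<open>P\<close> is a full preimage, so membership in it is independent of the
    representative and the Wick relation may be used inside it.\<close>
  define P where "P = {z. wick_class T z \<in> wick_class T ` S}"
  have P: "cvec.subspace P"
    unfolding P_def S_def
    by (intro submodule_wick_vimage submodule_wick_image cvec.subspace_span)
  have P_cong: "z' \<in> P" if "wick_class T z = wick_class T z'" "z \<in> P" for z z'
    using that by (simp add: P_def)
  have words: "word_monom (map Adj w) * gen_embed x * adj_embed y \<in> P" if "x \<in> ?J" for w x y
    using that
  \<comment> \<open>The last adjoint of \<open>w\<close> stands next to \<open>x\<close> and moves
    first. It is absorbed, or it leaves a transit of \<open>x\<close> and joins \<open>y\<close> on
    the left; both outcomes stay in the ideal, whence \<open>x\<close> and \<open>y\<close> are
    generalized.\<close>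
  proof (induction w arbitrary: x y rule: rev_induct)
    case Nil
    then have "gen_embed x * adj_embed y \<in> S"
      unfolding S_def by (intro cvec.span_base) blast
    then show ?case by (simp add: word_monom_Nil P_def)
  next
    case (snoc i w)
    let ?w = "word_monom (map Adj w) :: 'a letter free_alg"
    let ?r = "gen_embed (annih T i x) + (\<Sum>m\<in>UNIV. gen_embed (transit T i m x) * word_monom [Adj m])"
    have "?w * ?r * adj_embed y = ?w * gen_embed (annih T i x) * adj_embed y
        + (\<Sum>m\<in>UNIV. ?w * gen_embed (transit T i m x) * adj_embed (word_monom [m] * y))"
      by (simp add: distrib_left distrib_right sum_distrib_left sum_distrib_right adj_embed_mult mult.assoc)
    also have "\<dots> \<in> P"
      by (intro cvec.subspace_add[OF P] cvec.subspace_sum[OF P] snoc.IH ideal_span_annih[OF annih transit snoc.prems])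
    finally have "?w * ?r * adj_embed y \<in> P" .
    moreover have "wick_class T (?w * ?r * adj_embed y)
        = wick_class T (?w * (word_monom [Adj i] * gen_embed x) * adj_embed y)"
      by (intro wick_class_cong_mult wick_class_adj_gen_mult[symmetric] refl)
    ultimately have "?w * (word_monom [Adj i] * gen_embed x) * adj_embed y \<in> P"
      using P_cong by blast
    then show ?case by (simp add: mult.assoc[symmetric] word_monom_mult)
  qed
  have "adj_embed y * gen_embed x \<in> P" if x: "x \<in> ?J" for x y
  proof -
    have "cvec.span (range word_monom) \<subseteq> (\<lambda>y. adj_embed y * gen_embed x) -` P"
    proof (rule cvec.span_minimal)
      show "range word_monom \<subseteq> (\<lambda>y. adj_embed y * gen_embed x) -` P"
        using words[OF x, of _ 1] by auto
      show "cvec.subspace ((\<lambda>y. adj_embed y * gen_embed x) -` P)"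
        by (intro cpair.linear_subspace_vimage clinear_intros P)
    qed
    then show ?thesis by (auto simp: span_words)
  qed
  then have "cvec.span {y * x | y x. y \<in> range adj_embed \<and> x \<in> gen_embed ` ?J} \<subseteq> P"
    by (intro cvec.span_minimal P) auto
  then have "wick_tensor T (TH_dual T) (generated_ideal T I0) \<subseteq> wick_tensor T (generated_ideal T I0) (TH_dual T)"
    unfolding TH_dual_eq generated_ideal_eq to_wick_conv image_image[of "wick_class T" gen_embed, symmetric]
      wick_tensor_eq S_def[symmetric]
    by (auto simp: P_def)
  then show ?thesis
    by (simp add: wick_ideal_def generated_ideal_is_ideal)
qed


section \<open>The Fock representation\<close>

text \<open>The algebraic Fock representation on the tensor algebra with vacuum 1. It turns equality
  of classes into equations between tensors.\<close>

primrec fock_letter :: "('d::finite) coeffs \<Rightarrow> 'd letter \<Rightarrow> 'd free_alg \<Rightarrow> 'd free_alg" where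
  "fock_letter T (Gen i) x = word_monom [i] * x"
| "fock_letter T (Adj i) x = annih T i x"

definition fock :: "('d::finite) coeffs \<Rightarrow> 'd letter free_alg \<Rightarrow> 'd free_alg \<Rightarrow> 'd free_alg" where
  "fock T z x = lin_ext (\<lambda>w. foldr (fock_letter T) w x) z"

lemma clinear_fock_left [clinear_intros]: "clinear f \<Longrightarrow> clinear (\<lambda>z. fock T (f z) x)"
  unfolding fock_def by (rule clinear_lin_ext)

lemma clinear_fock_letter [clinear_intros]: "clinear f \<Longrightarrow> clinear (\<lambda>x. fock_letter T a (f x))"
  by (cases a) (simp_all, (intro clinear_intros; assumption)+)

lemma clinear_fock_right [clinear_intros]: "clinear f \<Longrightarrow> clinear (\<lambda>x. fock T z (f x))"
proof -
  assume f: "clinear f"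
  have "clinear (\<lambda>x. foldr (fock_letter T) w (f x))" for w
    by (induction w) (simp_all add: f clinear_fock_letter)
  then show ?thesis
    unfolding fock_def lin_ext_def by (intro clinear_intros)
qed

lemma fock_word_monom: "fock T (word_monom w) x = foldr (fock_letter T) w x"
  by (simp add: fock_def)

lemma fock_1 [simp]: "fock T 1 x = x"
  by (simp flip: word_monom_Nil add: fock_word_monom)

lemma fock_mult: "fock T (y * z) x = fock T y (fock T z x)"
proof (rule clinear_eq[where x = y and f = "\<lambda>y. fock T (y * z) x"])
  show "fock T (word_monom u * z) x = fock T (word_monom u) (fock T z x)" for u
    by (rule clinear_eq[where x = z and f = "\<lambda>z. fock T (word_monom u * z) x"])
       (intro clinear_intros | simp add: word_monom_mult fock_word_monom)+
qed (intro clinear_intros)+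

text \<open>The rule \<open>annih_gen_mult\<close> is the Wick relation read as an identity of
  operators.\<close>

lemma fock_wick_rel: "fock T (wick_rel T i j) x = 0"
proof -
  note lin = clinear_fock_left[OF clinear_ident, of T x]
  show ?thesis
    by (simp add: wick_rel_def cpair.linear_diff[OF lin] cpair.linear_add[OF lin] cpair.linear_sum[OF lin]
        cpair.linear_scale[OF lin] cpair.linear_0[OF lin] fock_word_monom annih_gen_mult if_distrib[of "\<lambda>z. fock T z x"])
qed

lemma free_star_wick_rel:
  assumes hermitian: "\<And>i j k l. T j i l k = cnj (T i j k l)"
  shows "free_star (wick_rel T i j) = wick_rel T j i"
proof -
  have zero: "free_star 0 = 0" by (simp add: free_star_def)
  have scale: "free_star (cscale c (word_monom w)) = cscale (cnj c) (word_monom (rev (map letter_star w)))" for c and w :: "'a letter list"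
    by (simp add: word_monom_def cscale_def free_star_single)
  have word: "free_star (word_monom w) = word_monom (rev (map letter_star w))" for w :: "'a letter list"
    by (simp add: word_monom_def free_star_single)
  have one: "free_star 1 = (1 :: 'a letter free_alg)"
    using word[of "[]"] by (simp add: word_monom_Nil)
  have diff: "free_star (x - y) = free_star x - free_star y" for x y :: "'a letter free_alg"
    by (metis free_star_add add_diff_cancel diff_add_cancel)
  have sum: "free_star (sum f A) = (\<Sum>a\<in>A. free_star (f a))" for f :: "'a \<Rightarrow> 'a letter free_alg" and A
    by (induction A rule: infinite_finite_induct) (simp_all add: zero free_star_add)
  \<comment> \<open>The involution exchanges the roles of \<open>k\<close> and \<open>l\<close>, and
    hermiticity turns the conjugated coefficient into \<open>T j i l k\<close>; exchanging the two
    summations restores the standard form.\<close>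
  have "(\<Sum>k\<in>UNIV. \<Sum>l\<in>UNIV. cscale (T j i l k) (word_monom [Gen k, Adj l]))
      = (\<Sum>k\<in>UNIV. \<Sum>l\<in>UNIV. cscale (T j i k l) (word_monom [Gen l, Adj k]))"
    by (rule sum.swap)
  then show ?thesis
    by (simp add: wick_rel_def diff free_star_add sum scale word one zero hermitian[symmetric] if_distrib[of free_star])
qed

text \<open>Consequently \<open>fock T z\<close> depends only on the class of \<open>z\<close>. By
  minimality of \<open>wick_rel_ideal\<close> it suffices to find one star-closed ideal that
  contains the relations and acts as zero; hermiticity makes the star of a relation a
  relation.\<close>

lemma fock_wick_rel_ideal:
  assumes hermitian: "\<And>i j k l. T j i l k = cnj (T i j k l)"
    and z: "z \<in> wick_rel_ideal T"
  shows "fock T z x = 0"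
proof -
  \<comment> \<open>The Fock kernel is not evidently *-closed, so it is intersected with its adjoint.\<close>
  let ?A = "{z. (\<forall>x. fock T z x = 0) \<and> (\<forall>x. fock T (free_star z) x = 0)}"
  interpret R: ring "free_ring :: 'a letter free_alg ring" by (rule ring_free_ring)
  note lin = clinear_fock_left[OF clinear_ident, of T] and rlin = clinear_fock_right[OF clinear_ident, of T]
  have [simp]: "carrier free_ring = (UNIV :: 'a letter free_alg set)" "a \<oplus>\<^bsub>free_ring\<^esub> b = a + b" "a \<otimes>\<^bsub>free_ring\<^esub> b = a * b"
      "\<zero>\<^bsub>free_ring\<^esub> = (0 :: 'a letter free_alg)"
    for a b :: "'a letter free_alg"
    by (simp_all add: ring_of_type_algebra_def)
  have neg: "\<ominus>\<^bsub>free_ring\<^esub> a = - a" for a :: "'a letter free_alg"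
    by (rule R.minus_equality) simp_all
  have star_zero: "free_star 0 = (0 :: 'a letter free_alg)" by (simp add: free_star_def)
  have star_neg: "free_star (- a) = - free_star a" for a :: "'a letter free_alg"
    using free_star_add[of a "- a"] star_zero by (simp add: eq_neg_iff_add_eq_0 add.commute)
  have "ideal ?A free_ring"
  proof (rule idealI[OF ring_free_ring])
    show "subgroup ?A (add_monoid free_ring)"
    proof (rule R.add.subgroupI)
      show "?A \<noteq> {}" using star_zero by (auto intro!: exI[of _ 0] simp: cpair.linear_0[OF lin])
    qed (auto simp: neg star_neg free_star_add cpair.linear_add[OF lin] cpair.linear_neg[OF lin])
  qed (auto simp: fock_mult free_star_mult cpair.linear_0[OF rlin])
  moreover have "wick_rel T i j \<in> ?A" for i j
    by (simp add: fock_wick_rel free_star_wick_rel[of T, OF hermitian])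
  ultimately have "wick_rel_ideal T \<subseteq> ?A"
    unfolding wick_rel_ideal_def by (intro Inter_lower) (auto simp: free_star_star)
  with z show ?thesis by blast
qed

section \<open>Action on the vacuum and comparison of degrees\<close>

lemma fock_gen_embed: "fock T (gen_embed x) y = x * y"
proof (rule clinear_eq[where x = x and f = "\<lambda>x. fock T (gen_embed x) y"])
  show "fock T (gen_embed (word_monom w)) y = word_monom w * y" for w
    by (induction w) (simp_all add: word_monom_Nil fock_word_monom mult.assoc[symmetric] word_monom_mult)
qed (intro clinear_intros)+

text \<open>Adjoint letters annihilate the vacuum, so only the constant term survives.\<close>

lemma fock_adj_embed_vacuum: "fock T (adj_embed y) 1 = cscale (Poly_Mapping.lookup y []) 1"
proof (rule clinear_eq[where x = y and f = "\<lambda>y. fock T (adj_embed y) 1"])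
  have "foldr (fock_letter T) (map Adj w) 1 = (if w = [] then 1 else 0)" for w
    by (induction w) (simp_all add: cpair.linear_0[OF clinear_annih[OF clinear_ident]])
  moreover have "Poly_Mapping.lookup (word_monom w) [] = (if w = [] then 1 else 0)" for w :: "'a list"
    by (simp add: word_monom_def lookup_single when_def)
  ultimately show "fock T (adj_embed (word_monom w)) 1 = cscale (Poly_Mapping.lookup (word_monom w) []) 1" for w
    by (simp add: fock_word_monom)
  show "clinear (\<lambda>y. cscale (Poly_Mapping.lookup y []) 1)"
    by (rule clinearI) (simp_all add: lookup_add cvec.scale_left_distrib)
qed (intro clinear_intros)

text \<open>Multiplying a generator of degree \<open>n\<close> on either side produces only words of
  length at least \<open>n\<close>.\<close>

lemma ideal_span_lookup_eq_0:
  assumes "I0 \<subseteq> tpow n" "y \<in> ideal_span I0" "length w < n"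
  shows "Poly_Mapping.lookup y w = 0"
proof -
  have "y \<in> {z. Poly_Mapping.lookup z w = 0}"
    using assms(2)
  proof (induction rule: ideal_span_induct[where f = "\<lambda>y. y"])
    case (gen u x v)
    have "length w' \<ge> n" if "w' \<in> Poly_Mapping.keys (u * x * v)" for w'
      using that keys_mult[of "u * x" v] keys_mult[of u x] gen assms(1)
      by (fastforce simp: tpow_def plus_list_def)
    then show ?case using assms(3) by (force simp: in_keys_iff)
  next
    case subspace
    show ?case by (rule cvec.subspaceI) (simp_all add: lookup_add)
  qed (rule clinear_ident)
  then show ?thesis by simp
qed

lemma homogeneous_wick_ideal_annih:
  assumes hermitian: "\<And>i j k l. T j i l k = cnj (T i j k l)"
    and I: "wick_ideal T (generated_ideal T I0)" and I0: "I0 \<subseteq> tpow (Suc n)" and x: "x \<in> I0"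
  shows "annih T i x = 0"
proof -
  let ?J = "ideal_span I0"
  let ?S = "{x * y | x y. x \<in> gen_embed ` ?J \<and> y \<in> range adj_embed}"
  let ?z = "word_monom [Adj i] * gen_embed x"
  have "word_monom [Adj i] = adj_embed (word_monom [i])" by simp
  then have "?z \<in> {y * x | y x. y \<in> range adj_embed \<and> x \<in> gen_embed ` ?J}"
    using ideal_span_base[OF x] by blast
  then have "wick_class T ?z \<in> wick_tensor T (TH_dual T) (generated_ideal T I0)"
    unfolding TH_dual_eq generated_ideal_eq to_wick_conv image_image[of "wick_class T" gen_embed, symmetric] wick_tensor_eq
    by (intro imageI cvec.span_base)
  also have "\<dots> \<subseteq> wick_tensor T (generated_ideal T I0) (TH_dual T)"
    using I by (simp add: wick_ideal_def)
  also have "\<dots> = wick_class T ` cvec.span ?S"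
    unfolding TH_dual_eq generated_ideal_eq to_wick_conv image_image[of "wick_class T" gen_embed, symmetric] wick_tensor_eq ..
  finally obtain z' where z': "z' \<in> cvec.span ?S" "wick_class T ?z = wick_class T z'" by blast
  note lin = clinear_fock_left[OF clinear_ident, of T 1]
  have "fock T (?z - z') 1 = 0"
    using z'(2) by (intro fock_wick_rel_ideal hermitian) (simp add: wick_class_eq_iff)
  \<comment> \<open>On the vacuum, \<open>gen_embed x\<close> creates \<open>x\<close>, and the
    adjoint letter then acts on it by \<open>annih T i\<close>.\<close>
  then have "annih T i x = fock T z' 1"
    by (simp add: cpair.linear_diff[OF lin] fock_mult fock_gen_embed fock_word_monom)
  \<comment> \<open>In each product the right factor acts on the vacuum as a scalar, which leaves a
    multiple of an element of the ideal.\<close>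
  moreover have "cvec.span ?S \<subseteq> (\<lambda>z. fock T z 1) -` ?J"
  proof (rule cvec.span_minimal)
    show "?S \<subseteq> (\<lambda>z. fock T z 1) -` ?J"
      by (auto simp: fock_mult fock_gen_embed fock_adj_embed_vacuum intro: ideal_span_closed)
  qed (intro cpair.linear_subspace_vimage lin subspace_ideal_span)
  ultimately have J: "annih T i x \<in> ?J" using z'(1) by auto
  \<comment> \<open>This degree is one below that of the generators, so every coefficient
    vanishes.\<close>
  have "annih T i x \<in> tpow n"
    using annih_tpow I0 x by blast
  then have "length w = n" if "w \<in> Poly_Mapping.keys (annih T i x)" for w
    using that by (simp add: tpow_def)
  then have "w \<notin> Poly_Mapping.keys (annih T i x)" for w
    using ideal_span_lookup_eq_0[OF I0 J, of w] by (metis in_keys_iff lessI)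
  then show ?thesis by (intro poly_mapping_eqI) (simp add: in_keys_iff)
qed

lemma largest_homogeneous_wick_ideal_ker_R_op:
  assumes hermitian: "\<And>i j k l. T j i l k = cnj (T i j k l)" and T: "braided T" and n: "n > 0"
  shows "largest_homogeneous_wick_ideal T n (generated_ideal T (ker_on n (R_op T n)))"
proof -
  let ?K = "ker_on n (R_op T n)"
  have "wick_ideal T (generated_ideal T ?K)"
  proof (rule wick_ideal_generated_ideal)
    show "annih T i x = 0" if "x \<in> ?K" for x i
      using that R_op_eq_0_iff_annih by (auto simp: ker_on_def)
    show "transit T i m x \<in> ?K" if "x \<in> ?K" for x i m
      using that R_op_transit[OF T] transit_tpow by (auto simp: ker_on_def)
  qed
  moreover have "cvec.subspace ?K"
    by (intro subspace_ker_on clinear_intros)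
  ultimately have "homogeneous_wick_ideal T n (generated_ideal T ?K)"
    unfolding homogeneous_wick_ideal_def by (auto simp: ker_on_def)
  moreover have "I' \<subseteq> generated_ideal T ?K" if "homogeneous_wick_ideal T n I'" for I'
  proof -
    obtain I0 where I0: "I0 \<subseteq> tpow n" "I' = generated_ideal T I0" "wick_ideal T I'"
      using \<open>homogeneous_wick_ideal T n I'\<close> by (auto simp: homogeneous_wick_ideal_def)
    obtain n' where n': "n = Suc n'" using n by (cases n) auto
    \<comment> \<open>For maximality it suffices to compare generating spaces: the Wick property
      forces every \<open>annih T i\<close> to vanish on \<open>I0\<close>, which is the kernel
      condition for R_n.\<close>
    have "I0 \<subseteq> ?K"
    proof
      fix x assume x: "x \<in> I0"
      have "annih T i x = 0" for i
        by (rule homogeneous_wick_ideal_annih[OF hermitian _ _ x]) (use I0 n' in auto)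
      then show "x \<in> ?K"
        using x I0(1) R_op_eq_0_iff_annih[of x n T] by (auto simp: ker_on_def)
    qed
    then show ?thesis
      unfolding I0(2) generated_ideal_eq by (intro image_mono ideal_span_mono)
  qed
  ultimately show ?thesis
    by (simp add: largest_homogeneous_wick_ideal_def)
qed

theorem proposition6:
  fixes T :: "('d::finite) coeffs"
  assumes hermitian: "\<And>i j k l. T j i l k = cnj (T i j k l)"
    and braided: "braided T"
    and ker1: "\<And>m. m \<ge> 2 \<Longrightarrow> ker_on (m + 1) (\<lambda>x. x - T_prod T m x) = {0}"
    and ker2: "\<And>m. m \<ge> 2 \<Longrightarrow> ker_on (m + 1) (\<lambda>x. x - T_at T 1 (T_prod T m x)) = {0}"
  shows "(\<forall>m\<ge>2. K_space T m = ker_on m (R_op T m)) \<and>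
         (\<forall>m\<ge>2. largest_homogeneous_wick_ideal T m (generated_ideal T (K_space T m)))"
proof -
  have K: "K_space T m = ker_on m (R_op T m)" if "m \<ge> 2" for m
    using K_space_eq_ker_R_op[OF braided ker1 ker2 that] .
  then show ?thesis
    using largest_homogeneous_wick_ideal_ker_R_op[of T, OF hermitian braided] by auto
qed

end
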